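(* Let $\Phi$ be a crystallographic root system of rank $n$ with positive system $\Phi^+$, let $k$ be a positive integer, and consider the $k$-Catalan arrangement of $\Phi$. Let $M=\{H_{\alpha_1}^{i_1},H_{\alpha_2}^{i_2},\ldots,H_{\alpha_m}^{i_m}\}$ be any set of $m$ hyperplanes with $i_j\in\{1,\ldots,k\}$ and $\alpha_j\in\Phi^+$ for all $j\in\{1,\ldots,m\}$. Let $U(M)$ be the set of dominant regions $R$ of the $k$-Catalan arrangement such that every hyperplane in $M$ is a floor of $R$, and let $L(M)$ be the set of dominant regions $R'$ of the $k$-Catalan arrangement such that every hyperplane in $M$ is a ceiling of $R'$. Then there is a bijection from $U(M)$ to $L(M)$.
   Context: $\Phi$ lives in a real Euclidean space $V$ with inner product $\langle\cdot,\cdot\rangle$. For $\alpha\in\Phi$ and $r\in\mathbb{R}$ let $H_\alpha^r=\{x\in V\mid\langle x,\alpha\rangle=r\}$. The $k$-Catalan arrangement of $\Phi$ is the set of hyperplanes $H_\alpha^r$ with $\alpha\in\Phi$ and $r\in\{0,1,\ldots,k\}$; its regions are the connected components of the complement of the union of these hyperplanes. A region $R$ is dominant if $\langle x,\alpha\rangle>0$ for all $\alpha\in\Phi^+$ and $x\in R$. The walls of a region $R$ are the hyperplanes of the arrangement that support a facet of $R$. A ceiling of $R$ is a wall of $R$ that does not contain the origin and such that the origin lies on the same side of it as $R$. A floor of $R$ is a wall of $R$ that does not contain the origin and separates $R$ from the origin. *)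

theory Defs
  imports "HOL-Analysis.Analysis"
begin

definition crystallographic_root_system :: "'a::euclidean_space set \<Rightarrow> bool" where
  "crystallographic_root_system \<Phi> \<longleftrightarrow>
     finite \<Phi> \<and> 0 \<notin> \<Phi> \<and> span \<Phi> = UNIV \<and>
     (\<forall>\<alpha>\<in>\<Phi>. \<forall>c::real. c *\<^sub>R \<alpha> \<in> \<Phi> \<longrightarrow> c = 1 \<or> c = -1) \<and>
     (\<forall>\<alpha>\<in>\<Phi>. \<forall>\<beta>\<in>\<Phi>. \<beta> - (2 * (\<beta> \<bullet> \<alpha>) / (\<alpha> \<bullet> \<alpha>)) *\<^sub>R \<alpha> \<in> \<Phi>) \<and>
     (\<forall>\<alpha>\<in>\<Phi>. \<forall>\<beta>\<in>\<Phi>. 2 * (\<beta> \<bullet> \<alpha>) / (\<alpha> \<bullet> \<alpha>) \<in> \<int>)"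

definition positive_system :: "'a::euclidean_space set \<Rightarrow> 'a set \<Rightarrow> bool" where
  "positive_system \<Phi> \<Phi>p \<longleftrightarrow>
     (\<exists>v. (\<forall>\<alpha>\<in>\<Phi>. \<alpha> \<bullet> v \<noteq> 0) \<and> \<Phi>p = {\<alpha>\<in>\<Phi>. \<alpha> \<bullet> v > 0})"

definition hyp :: "'a::euclidean_space \<Rightarrow> real \<Rightarrow> 'a set" where
  "hyp \<alpha> r = {x. x \<bullet> \<alpha> = r}"

definition catalan_arr :: "'a::euclidean_space set \<Rightarrow> nat \<Rightarrow> 'a set set" where
  "catalan_arr \<Phi> k = {hyp \<alpha> (real r) | \<alpha> r. \<alpha> \<in> \<Phi> \<and> r \<in> {0..k}}"

definition regions :: "'a::euclidean_space set set \<Rightarrow> 'a set set" where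
  "regions A = components (- \<Union>A)"

definition dominant :: "'a::euclidean_space set \<Rightarrow> 'a set \<Rightarrow> bool" where
  "dominant \<Phi>p R \<longleftrightarrow> (\<forall>x\<in>R. \<forall>\<alpha>\<in>\<Phi>p. x \<bullet> \<alpha> > 0)"

definition wall :: "'a::euclidean_space set set \<Rightarrow> 'a set \<Rightarrow> 'a set \<Rightarrow> bool" where
  "wall A R H \<longleftrightarrow> H \<in> A \<and> (closure R \<inter> H) facet_of (closure R)"

definition ceiling :: "'a::euclidean_space set set \<Rightarrow> 'a set \<Rightarrow> 'a set \<Rightarrow> bool" where
  "ceiling A R H \<longleftrightarrow> wall A R H \<and> 0 \<notin> H \<and> (\<forall>x\<in>R. closed_segment 0 x \<inter> H = {})"

definition floor_wall :: "'a::euclidean_space set set \<Rightarrow> 'a set \<Rightarrow> 'a set \<Rightarrow> bool" where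
  "floor_wall A R H \<longleftrightarrow> wall A R H \<and> 0 \<notin> H \<and> (\<forall>x\<in>R. closed_segment 0 x \<inter> H \<noteq> {})"

end

theory Submission
  imports Defs
begin

text \<open>
  Signed affine roots turn floors and ceilings into the same thing: a wall \<open>y \<bullet> \<alpha> = i\<close> of \<open>R\<close> with
  \<open>y \<bullet> \<alpha> > i\<close> on \<open>R\<close>, where \<open>\<alpha>\<close> is positive for floors and negative for ceilings. The bijection sends
  \<open>R\<close> to the region on the other side of \<open>\<Inter>M\<close>, the one separated from \<open>R\<close> by exactly those
  hyperplanes of the arrangement that contain \<open>\<Inter>M\<close>. It exists because the walls in \<open>M\<close> meet in a
  face of \<open>R\<close> of the expected dimension. To see this, pick \<open>x \<in> R\<close> in the alcove of \<open>R\<close> nearest to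
  the origin (floors) or, after discarding the roots unbounded on \<open>R\<close>, farthest from it (ceilings).
  Every wall in \<open>M\<close> is then a wall of that alcove, alcove walls have pairwise obtuse normals, and so the
  orthogonal projection of \<open>x\<close> onto \<open>\<Inter>M\<close> stays in the closed alcove.
\<close>

section \<open>Obtuse families of vectors\<close>

text \<open>The arrangement sees an inequality \<open>i < x \<bullet> \<alpha>\<close> only for
  \<open>\<bar>i\<bar> \<le> k\<close>, whereas the obtuseness of alcove walls compares the levels
  of three roots \<open>\<alpha>\<close>, \<open>\<beta>\<close>, \<open>\<alpha> - \<beta>\<close>,
  some of them possibly out of that range. The obstacle is to make unseen inequalities follow from
  seen ones. At the extremal alcove every root (of the relevant sign) whose level is out of range
  decomposes, and this is what transports the inequalities of the alcove to all of \<open>R\<close>.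

  For ceilings \<open>R\<close> may be unbounded and a farthest alcove need not exist. The roots
  bounded on \<open>R\<close> form a closed subsystem that contains the root of every ceiling; the
  other positive roots can be made as large as desired without changing the alcove of the subsystem.

  No inverse map is constructed: \<open>crossing\<close> is a symmetric relation in which a region
  has at most one partner, so it suffices to find partners for floors and for ceilings.\<close>

definition obtuse :: "'a::euclidean_space set \<Rightarrow> bool" where
  "obtuse S \<longleftrightarrow> (\<forall>a\<in>S. \<forall>b\<in>S. a \<noteq> b \<longrightarrow> a \<bullet> b \<le> 0)"

lemma obtuse_sums:
  fixes S :: "'a::euclidean_space set"
  assumes "obtuse S" "A \<subseteq> S" "B \<subseteq> S" "A \<inter> B = {}"
    and "\<And>a. a \<in> A \<Longrightarrow> s a \<ge> 0" "\<And>b. b \<in> B \<Longrightarrow> t b \<ge> 0"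
  shows "(\<Sum>a\<in>A. s a *\<^sub>R a) \<bullet> (\<Sum>b\<in>B. t b *\<^sub>R b) \<le> 0"
proof -
  have "t b * (s a * (a \<bullet> b)) \<le> 0" if "a \<in> A" "b \<in> B" for a b
  proof -
    have "a \<in> S" "b \<in> S" "a \<noteq> b" using assms(2-4) that by auto
    then have "a \<bullet> b \<le> 0" using assms(1) unfolding obtuse_def by simp
    then show ?thesis using assms(5)[OF that(1)] assms(6)[OF that(2)]
      by (intro mult_nonneg_nonpos)
  qed
  then show ?thesis
    unfolding inner_sum_left inner_scaleR_left inner_sum_right inner_scaleR_right sum_distrib_left
    by (intro sum_nonpos) auto
qed

lemma sum_pos_neg_parts:
  fixes S :: "'a::euclidean_space set"
  assumes "finite S"
  shows "(\<Sum>a\<in>S. t a *\<^sub>R a) =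
    (\<Sum>a\<in>{a\<in>S. t a > 0}. t a *\<^sub>R a) - (\<Sum>a\<in>{a\<in>S. t a < 0}. (- t a) *\<^sub>R a)"
proof -
  have "(\<Sum>a\<in>S. t a *\<^sub>R a) =
      (\<Sum>a\<in>S. (if t a > 0 then t a *\<^sub>R a else 0) - (if t a < 0 then (- t a) *\<^sub>R a else 0))"
    by (rule sum.cong) auto
  then show ?thesis
    using assms by (simp add: sum_subtractf sum.inter_filter cong: if_cong)
qed

text \<open>The negative part \<open>N\<close> is killed by positivity:
  \<open>v \<bullet> N \<ge> 0\<close> while \<open>P \<bullet> N \<le> 0\<close>, so
  \<open>N \<bullet> N \<le> 0\<close>. Geometrically, inside the span of an obtuse family the dual
  cone is contained in the cone generated by the family.\<close>

lemma obtuse_nonneg_coeffs: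
  fixes S :: "'a::euclidean_space set"
  assumes "finite S" "obtuse S" and v: "v = (\<Sum>a\<in>S. t a *\<^sub>R a)"
    and ge: "\<And>a. a \<in> S \<Longrightarrow> v \<bullet> a \<ge> 0"
  shows "\<exists>s. (\<forall>a\<in>S. s a \<ge> 0) \<and> v = (\<Sum>a\<in>S. s a *\<^sub>R a)"
proof -
  define P where "P = (\<Sum>a\<in>{a\<in>S. t a > 0}. t a *\<^sub>R a)"
  define N where "N = (\<Sum>a\<in>{a\<in>S. t a < 0}. (- t a) *\<^sub>R a)"
  have vPN: "v = P - N" unfolding v P_def N_def using sum_pos_neg_parts[OF assms(1)] .
  have "P \<bullet> N \<le> 0" unfolding P_def N_def
    by (rule obtuse_sums[OF assms(2)]) auto
  moreover have "v \<bullet> N \<ge> 0" unfolding N_def inner_sum_right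
    by (rule sum_nonneg) (use ge in \<open>auto simp: mult_nonpos_nonneg\<close>)
  ultimately have "N \<bullet> N \<le> 0" unfolding vPN by (simp add: inner_diff_left)
  then have "v = P" using vPN inner_ge_zero[of N] by (metis antisym diff_zero inner_eq_zero_iff)
  also have "P = (\<Sum>a\<in>S. max 0 (t a) *\<^sub>R a)"
    unfolding P_def sum.inter_filter[OF assms(1)] by (rule sum.cong) auto
  finally show ?thesis by (intro exI[of _ "\<lambda>a. max 0 (t a)"]) auto
qed

text \<open>The argument for simple roots: a linear relation says \<open>P = N\<close> for
  combinations with disjoint supports, so both are 0, and pairing with \<open>w\<close> excludes any
  nonzero coefficient.\<close>

lemma obtuse_independent:
  fixes S :: "'a::euclidean_space set"
  assumes "finite S" "obtuse S" and w: "\<And>a. a \<in> S \<Longrightarrow> a \<bullet> w > 0"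
  shows "independent S"
proof -
  have "t a = 0" if t: "(\<Sum>a\<in>S. t a *\<^sub>R a) = 0" and a: "a \<in> S" for t a
  proof -
    define P where "P = (\<Sum>a\<in>{a\<in>S. t a > 0}. t a *\<^sub>R a)"
    define N where "N = (\<Sum>a\<in>{a\<in>S. t a < 0}. (- t a) *\<^sub>R a)"
    have eq: "P = N" using t sum_pos_neg_parts[OF assms(1), of t] unfolding P_def N_def by simp
    have "P \<bullet> N \<le> 0" unfolding P_def N_def
      by (rule obtuse_sums[OF assms(2)]) auto
    then have P0: "P = 0" and N0: "N = 0" using eq inner_ge_zero[of N] by (metis antisym inner_eq_zero_iff)+
    show ?thesis
    proof (rule ccontr)
      assume "t a \<noteq> 0"
      then consider "t a > 0" | "t a < 0" by linarith
      then show False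
      proof cases
        case 1
        have "P \<bullet> w > 0" unfolding P_def inner_sum_left
          by (rule sum_pos2[of _ a]) (use 1 a assms(1) w in \<open>auto intro: less_imp_le\<close>)
        then show False using P0 by simp
      next
        case 2
        have "N \<bullet> w > 0" unfolding N_def inner_sum_left
          by (rule sum_pos2[of _ a]) (use 2 a assms(1) w in \<open>auto intro: less_imp_le simp: mult_less_0_iff mult_le_0_iff\<close>)
        then show False using N0 by simp
      qed
    qed
  qed
  then show ?thesis using dependent_finite[OF assms(1)] by blast
qed

text \<open>A coordinate functional is extended linearly, represented by a vector and projected to
  \<open>span S\<close>. Lying in the span is what later makes subtracting multiples of
  \<open>u a\<close> an orthogonal projection.\<close>

lemma dual_family_exists:
  fixes S :: "'a::euclidean_space set"
  assumes "independent S"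
  shows "\<exists>u. \<forall>a\<in>S. u a \<in> span S \<and> (\<forall>b\<in>S. u a \<bullet> b = (if a = b then 1 else 0))"
proof -
  have "\<exists>u. u \<in> span S \<and> (\<forall>b\<in>S. u \<bullet> b = (if a = b then 1 else 0))" if "a \<in> S" for a
  proof -
    obtain g :: "'a \<Rightarrow> real" where g: "linear g" "\<forall>x\<in>S. g x = (if a = x then 1 else 0)"
      using linear_independent_extend[OF assms, of "\<lambda>x. if a = x then 1 else 0"] by blast
    define y where "y = (\<Sum>b\<in>Basis. g b *\<^sub>R b)"
    have gy: "g x = y \<bullet> x" for x
    proof -
      have "g x = g (\<Sum>b\<in>Basis. (x \<bullet> b) *\<^sub>R b)" by (simp add: euclidean_representation)
      also have "\<dots> = (\<Sum>b\<in>Basis. (x \<bullet> b) * g b)"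
        using g(1) by (simp add: linear_sum linear_cmul)
      also have "\<dots> = y \<bullet> x" unfolding y_def by (simp add: inner_sum_left inner_commute[of x] mult.commute)
      finally show ?thesis .
    qed
    obtain c z where cz: "c \<in> span S" "\<And>w. w \<in> span S \<Longrightarrow> orthogonal z w" "y = c + z"
      using orthogonal_subspace_decomp_exists[of S y] by metis
    have "c \<bullet> b = (if a = b then 1 else 0)" if "b \<in> S" for b
    proof -
      have "z \<bullet> b = 0" using cz(2)[OF span_base[OF that]] by (simp add: orthogonal_def)
      then show ?thesis using gy[of b] g(2) that cz(3) by (auto simp: inner_add_left)
    qed
    then show ?thesis using cz(1) by blast
  qed
  then show ?thesis by metis
qed

section \<open>Roots and regions\<close>

text \<open>The root system is reduced, so the two roots are not parallel and Cauchy-Schwarz is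
  strict: the positive Cartan integers \<open>m\<close> and \<open>n\<close> have product below 4.
  One of them is 1, and the corresponding reflection yields the difference up to sign.\<close>

lemma root_diff:
  fixes \<Phi> :: "'a::euclidean_space set"
  assumes cr: "crystallographic_root_system \<Phi>" and ab: "\<alpha> \<in> \<Phi>" "\<beta> \<in> \<Phi>" "\<alpha> \<noteq> \<beta>" "\<alpha> \<bullet> \<beta> > 0"
  shows "\<alpha> - \<beta> \<in> \<Phi>"
proof -
  have nz: "0 \<notin> \<Phi>" and red: "\<And>\<alpha> c. \<alpha> \<in> \<Phi> \<Longrightarrow> c *\<^sub>R \<alpha> \<in> \<Phi> \<Longrightarrow> c = 1 \<or> c = -1"
    and refl: "\<And>\<alpha> \<beta>. \<alpha> \<in> \<Phi> \<Longrightarrow> \<beta> \<in> \<Phi> \<Longrightarrow> \<beta> - (2 * (\<beta> \<bullet> \<alpha>) / (\<alpha> \<bullet> \<alpha>)) *\<^sub>R \<alpha> \<in> \<Phi>"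
    and int: "\<And>\<alpha> \<beta>. \<alpha> \<in> \<Phi> \<Longrightarrow> \<beta> \<in> \<Phi> \<Longrightarrow> 2 * (\<beta> \<bullet> \<alpha>) / (\<alpha> \<bullet> \<alpha>) \<in> \<int>"
    using cr unfolding crystallographic_root_system_def by blast+
  have a0: "\<alpha> \<bullet> \<alpha> > 0" and b0: "\<beta> \<bullet> \<beta> > 0" using ab nz by auto
  obtain m :: int where m: "2 * (\<beta> \<bullet> \<alpha>) / (\<alpha> \<bullet> \<alpha>) = m" using int[OF ab(1,2)] by (auto elim: Ints_cases)
  obtain n :: int where n: "2 * (\<alpha> \<bullet> \<beta>) / (\<beta> \<bullet> \<beta>) = n" using int[OF ab(2,1)] by (auto elim: Ints_cases)
  have m0: "real_of_int m > 0" and n0: "real_of_int n > 0"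
    unfolding m[symmetric] n[symmetric] using a0 b0 ab(4) by (auto simp: inner_commute)
  have "\<bar>\<alpha> \<bullet> \<beta>\<bar> \<noteq> norm \<alpha> * norm \<beta>"
  proof
    assume "\<bar>\<alpha> \<bullet> \<beta>\<bar> = norm \<alpha> * norm \<beta>"
    then have "\<alpha> \<bullet> \<beta> = norm \<alpha> * norm \<beta>" using ab(4) by simp
    then have "norm \<alpha> *\<^sub>R \<beta> = norm \<beta> *\<^sub>R \<alpha>" using norm_cauchy_schwarz_eq by blast
    then have "(1 / norm \<alpha>) *\<^sub>R (norm \<alpha> *\<^sub>R \<beta>) = (1 / norm \<alpha>) *\<^sub>R (norm \<beta> *\<^sub>R \<alpha>)" by simp
    then have be: "\<beta> = (norm \<beta> / norm \<alpha>) *\<^sub>R \<alpha>" using a0 by simp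
    then have "norm \<beta> / norm \<alpha> = 1 \<or> norm \<beta> / norm \<alpha> = -1" using red[OF ab(1)] ab(2) by metis
    moreover have "norm \<beta> / norm \<alpha> \<ge> 0" by simp
    ultimately have "norm \<beta> / norm \<alpha> = 1" by linarith
    then show False using be ab(3) by (metis scaleR_one)
  qed
  then have "\<bar>\<alpha> \<bullet> \<beta>\<bar> < norm \<alpha> * norm \<beta>" using Cauchy_Schwarz_ineq2[of \<alpha> \<beta>] by simp
  then have "(\<alpha> \<bullet> \<beta>) * (\<alpha> \<bullet> \<beta>) < (norm \<alpha> * norm \<beta>) * (norm \<alpha> * norm \<beta>)"
    using ab(4) by (intro mult_strict_mono) auto
  also have "\<dots> = (\<alpha> \<bullet> \<alpha>) * (\<beta> \<bullet> \<beta>)"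
    by (simp add: dot_square_norm power2_eq_square)
  finally have "real_of_int m * real_of_int n < 4"
    unfolding m[symmetric] n[symmetric] using a0 b0
    by (simp add: field_simps inner_commute)
  then have "m * n < 4" by (metis of_int_less_iff of_int_mult of_int_numeral)
  moreover have "m > 0" "n > 0" using m0 n0 by simp_all
  moreover have "m * n \<ge> 4" if "m \<ge> 2" "n \<ge> 2"
    using mult_mono[of 2 m 2 n] that by simp
  ultimately have "m = 1 \<or> n = 1" by linarith
  then show ?thesis
  proof
    assume "m = 1"
    then have "\<beta> - \<alpha> \<in> \<Phi>" using refl[OF ab(1,2)] m by simp
    \<comment> \<open>The reflection in a root negates that root, which turns
      \<open>\<beta> - \<alpha>\<close> into \<open>\<alpha> - \<beta>\<close>.\<close>
    then show ?thesis using refl[of "\<beta> - \<alpha>" "\<beta> - \<alpha>"] nz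
      by (cases "\<beta> = \<alpha>") (auto simp: scaleR_2)
  next
    assume "n = 1"
    then show ?thesis using refl[OF ab(2,1)] n by simp
  qed
qed

lemma root_uminus:
  assumes "crystallographic_root_system \<Phi>" "\<alpha> \<in> \<Phi>"
  shows "- \<alpha> \<in> \<Phi>"
proof -
  have "\<alpha> \<noteq> 0" "\<alpha> - (2 * (\<alpha> \<bullet> \<alpha>) / (\<alpha> \<bullet> \<alpha>)) *\<^sub>R \<alpha> \<in> \<Phi>"
    using assms unfolding crystallographic_root_system_def by (blast, blast)
  then show ?thesis by (simp add: scaleR_2)
qed

section \<open>The arrangement, and its regions as classes of equal signs\<close>

locale root_arrangement =
  fixes \<Phi> :: "'a::euclidean_space set" and v :: 'a and k :: nat
  assumes crys: "crystallographic_root_system \<Phi>"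
    and regular: "\<And>\<alpha>. \<alpha> \<in> \<Phi> \<Longrightarrow> \<alpha> \<bullet> v \<noteq> 0"
begin

lemma finite_roots: "finite \<Phi>" using crys unfolding crystallographic_root_system_def by blast
lemma root_nonzero: "\<alpha> \<in> \<Phi> \<Longrightarrow> \<alpha> \<noteq> 0" using crys unfolding crystallographic_root_system_def by blast
lemma root_scale: "\<alpha> \<in> \<Phi> \<Longrightarrow> c *\<^sub>R \<alpha> \<in> \<Phi> \<Longrightarrow> c = 1 \<or> c = -1"
  using crys unfolding crystallographic_root_system_def by blast

text \<open>The vector \<open>v\<close> also provides a height: later inductions run along
  \<open>\<alpha> \<bullet> w\<close> with \<open>w = v\<close> for floors and
  \<open>w = - v\<close> for ceilings.\<close>

definition pos :: "'a set" where "pos = {\<alpha>\<in>\<Phi>. \<alpha> \<bullet> v > 0}"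

lemma pos_or_neg: "\<alpha> \<in> \<Phi> \<Longrightarrow> \<alpha> \<in> pos \<or> - \<alpha> \<in> pos"
  using regular[of \<alpha>] root_uminus[OF crys] unfolding pos_def by (auto simp: not_less_iff_gr_or_eq)

text \<open>Levels of both signs are tested, although the arrangement is given by
  \<open>0..k\<close>: the hyperplanes are the same because roots come with their negatives, and
  every test then has a negated counterpart.\<close>

definition generic :: "'a \<Rightarrow> bool" where
  "generic x \<longleftrightarrow> (\<forall>\<alpha>\<in>\<Phi>. \<forall>i::int. \<bar>i\<bar> \<le> int k \<longrightarrow> x \<bullet> \<alpha> \<noteq> of_int i)"

definition same_side :: "'a \<Rightarrow> 'a \<Rightarrow> bool" where
  "same_side x y \<longleftrightarrow> (\<forall>\<alpha>\<in>\<Phi>. \<forall>i::int. \<bar>i\<bar> \<le> int k \<longrightarrow> (of_int i < x \<bullet> \<alpha> \<longleftrightarrow> of_int i < y \<bullet> \<alpha>))"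

lemma mem_arr_iff: "H \<in> catalan_arr \<Phi> k \<longleftrightarrow> (\<exists>\<alpha>\<in>\<Phi>. \<exists>i::int. \<bar>i\<bar> \<le> int k \<and> H = hyp \<alpha> (of_int i))"
proof
  assume "H \<in> catalan_arr \<Phi> k"
  then obtain \<alpha> r where "H = hyp \<alpha> (real r)" "\<alpha> \<in> \<Phi>" "r \<le> k" unfolding catalan_arr_def by auto
  then show "\<exists>\<alpha>\<in>\<Phi>. \<exists>i::int. \<bar>i\<bar> \<le> int k \<and> H = hyp \<alpha> (of_int i)"
    by (intro bexI[of _ \<alpha>] exI[of _ "int r"]) auto
next
  assume "\<exists>\<alpha>\<in>\<Phi>. \<exists>i::int. \<bar>i\<bar> \<le> int k \<and> H = hyp \<alpha> (of_int i)"
  then obtain \<alpha> i where a: "\<alpha> \<in> \<Phi>" "\<bar>i\<bar> \<le> int k" "H = hyp \<alpha> (of_int i)" by blast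
  show "H \<in> catalan_arr \<Phi> k"
  proof (cases "i \<ge> 0")
    case True
    then show ?thesis using a unfolding catalan_arr_def
      by (intro CollectI exI[of _ \<alpha>] exI[of _ "nat i"]) auto
  next
    case False
    moreover have "hyp \<alpha> (of_int i) = hyp (- \<alpha>) (real (nat (- i)))" using False by (auto simp: hyp_def)
    ultimately show ?thesis using a root_uminus[OF crys a(1)] unfolding catalan_arr_def
      by (intro CollectI exI[of _ "- \<alpha>"] exI[of _ "nat (- i)"]) auto
  qed
qed

lemma generic_iff: "generic x \<longleftrightarrow> x \<in> - \<Union>(catalan_arr \<Phi> k)"
proof -
  have "x \<in> \<Union>(catalan_arr \<Phi> k) \<longleftrightarrow> (\<exists>\<alpha>\<in>\<Phi>. \<exists>i::int. \<bar>i\<bar> \<le> int k \<and> x \<in> hyp \<alpha> (of_int i))"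
    unfolding Union_iff Bex_def mem_arr_iff by blast
  then show ?thesis unfolding generic_def hyp_def by auto
qed

lemma same_side_refl: "same_side x x" by (simp add: same_side_def)
lemma same_side_sym: "same_side x y \<Longrightarrow> same_side y x" by (simp add: same_side_def)
lemma same_side_trans: "same_side x y \<Longrightarrow> same_side y z \<Longrightarrow> same_side x z" by (simp add: same_side_def)

text \<open>The test for \<open>- \<alpha>\<close> at \<open>- i\<close> is the reversed strict
  inequality for \<open>\<alpha>\<close> at \<open>i\<close>, so the one-sided tests in
  \<open>same_side\<close> control both sides.\<close>

lemma same_side_less:
  assumes "generic x" "same_side x y" "\<alpha> \<in> \<Phi>" "\<bar>i\<bar> \<le> int k"
  shows "x \<bullet> \<alpha> < of_int i \<longleftrightarrow> y \<bullet> \<alpha> < of_int i"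
  using assms(2)[unfolded same_side_def, rule_format, of "- \<alpha>" "- i"] root_uminus[OF crys assms(3)] assms(4) by auto

lemma same_side_generic:
  assumes "generic x" "same_side x y" shows "generic y"
  unfolding generic_def
proof (intro ballI allI impI)
  fix \<alpha> i assume a: "\<alpha> \<in> \<Phi>" "\<bar>i\<bar> \<le> int k"
  have "of_int i < x \<bullet> \<alpha> \<longleftrightarrow> of_int i < y \<bullet> \<alpha>" using assms(2) a unfolding same_side_def by blast
  moreover have "x \<bullet> \<alpha> \<noteq> i" using assms(1) a unfolding generic_def by blast
  ultimately show "y \<bullet> \<alpha> \<noteq> i" using same_side_less[OF assms a] by linarith
qed

lemma convex_same_side: 
  assumes "generic x" shows "convex {y. same_side x y}"
proof -
  have "{y. same_side x y} = (\<Inter>\<alpha>\<in>\<Phi>. \<Inter>i\<in>{i. \<bar>i\<bar> \<le> int k}. {y. (of_int i < x \<bullet> \<alpha>) = (of_int i < y \<bullet> \<alpha>)})"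
    unfolding same_side_def by blast
  moreover have "convex {y. (of_int i < x \<bullet> \<alpha>) = (of_int i < y \<bullet> \<alpha>)}" for i \<alpha>
    using convex_halfspace_gt[of "of_int i" \<alpha>] convex_halfspace_le[of \<alpha> "of_int i"]
    by (cases "of_int i < x \<bullet> \<alpha>") (simp_all add: inner_commute not_less)
  ultimately show ?thesis by (simp add: convex_INT)
qed

lemma open_same_side: 
  assumes "generic x" shows "open {y. same_side x y}"
proof -
  \<comment> \<open>Points on the same side as a generic point are generic, so a failing test
    \<open>i < y \<bullet> \<alpha>\<close> becomes the open condition
    \<open>y \<bullet> \<alpha> < i\<close>.\<close>
  have "{y. same_side x y} = (\<Inter>\<alpha>\<in>\<Phi>. \<Inter>i\<in>{- int k..int k}. {y. if of_int i < x \<bullet> \<alpha> then of_int i < \<alpha> \<bullet> y else \<alpha> \<bullet> y < of_int i})"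
    (is "?L = ?R")
  proof (intro equalityI subsetI)
    fix y assume y: "y \<in> ?L"
    have "if of_int i < x \<bullet> \<alpha> then of_int i < \<alpha> \<bullet> y else \<alpha> \<bullet> y < of_int i"
      if a: "\<alpha> \<in> \<Phi>" "i \<in> {- int k..int k}" for \<alpha> i
    proof -
      have i: "\<bar>i\<bar> \<le> int k" using a by auto
      have "of_int i < x \<bullet> \<alpha> \<longleftrightarrow> of_int i < y \<bullet> \<alpha>" using y a i unfolding same_side_def by blast
      moreover have "generic y" using same_side_generic[OF assms] y by blast
      then have "y \<bullet> \<alpha> \<noteq> i" using a i unfolding generic_def by blast
      ultimately show ?thesis by (auto simp: inner_commute)
    qed
    then show "y \<in> ?R" by blast
  next
    fix y assume y: "y \<in> ?R"
    have "of_int i < x \<bullet> \<alpha> \<longleftrightarrow> of_int i < y \<bullet> \<alpha>" if a: "\<alpha> \<in> \<Phi>" "\<bar>i\<bar> \<le> int k" for \<alpha> i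
    proof -
      have "i \<in> {- int k..int k}" using a by auto
      then have "if of_int i < x \<bullet> \<alpha> then of_int i < \<alpha> \<bullet> y else \<alpha> \<bullet> y < of_int i" using y a by blast
      then show ?thesis by (auto simp: inner_commute split: if_splits)
    qed
    then show "y \<in> ?L" unfolding same_side_def by blast
  qed
  moreover have "open {y. if of_int i < x \<bullet> \<alpha> then of_int i < \<alpha> \<bullet> y else \<alpha> \<bullet> y < of_int i}" for i \<alpha>
    using open_halfspace_gt[of "of_int i" \<alpha>] open_halfspace_lt[of \<alpha> "of_int i"]
    by (cases "of_int i < x \<bullet> \<alpha>") (simp_all add: inner_commute not_less)
  ultimately show ?thesis using finite_roots by (simp add: open_INT)
qed

text \<open>By the intermediate value theorem a connected set that avoids the hyperplanes cannot
  change side; conversely the class of \<open>x\<close> is convex and avoids them.\<close>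

lemma component_eq:
  assumes "generic x"
  shows "connected_component_set (- \<Union>(catalan_arr \<Phi> k)) x = {y. same_side x y}"
proof (intro equalityI subsetI)
  fix y assume "y \<in> connected_component_set (- \<Union>(catalan_arr \<Phi> k)) x"
  then obtain T where T: "connected T" "T \<subseteq> - \<Union>(catalan_arr \<Phi> k)" "x \<in> T" "y \<in> T"
    unfolding connected_component_def by auto
  have "of_int i < x \<bullet> \<alpha> \<longleftrightarrow> of_int i < y \<bullet> \<alpha>" if a: "\<alpha> \<in> \<Phi>" "\<bar>i\<bar> \<le> int k" for \<alpha> i
  proof -
    have no: "z \<bullet> \<alpha> \<noteq> i" if "z \<in> T" for z
    proof -
      have "generic z" using that T(2) generic_iff by blast
      then show ?thesis using a unfolding generic_def by blast
    qed
    show ?thesis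
      using connected_ivt_hyperplane[OF T(1,3,4), of \<alpha> i] connected_ivt_hyperplane[OF T(1,4,3), of \<alpha> i] no
      by (metis inner_commute linorder_le_less_linear order_less_imp_le)
  qed
  then show "y \<in> {y. same_side x y}" unfolding same_side_def by blast
next
  fix y assume y: "y \<in> {y. same_side x y}"
  have "connected {y. same_side x y}" using convex_same_side[OF assms] convex_connected by blast
  moreover have "{y. same_side x y} \<subseteq> - \<Union>(catalan_arr \<Phi> k)"
    using same_side_generic[OF assms] generic_iff by blast
  ultimately show "y \<in> connected_component_set (- \<Union>(catalan_arr \<Phi> k)) x"
    using y same_side_refl unfolding connected_component_def by blast
qed

lemma regions_iff: "R \<in> regions (catalan_arr \<Phi> k) \<longleftrightarrow> (\<exists>x. generic x \<and> R = {y. same_side x y})"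
  unfolding regions_def components_iff using component_eq generic_iff by metis

lemma region_eq:
  assumes "R \<in> regions (catalan_arr \<Phi> k)" "x \<in> R"
  shows "generic x" "R = {y. same_side x y}"
proof -
  obtain z where z: "generic z" "R = {y. same_side z y}" using assms(1) regions_iff by blast
  then show "generic x" using same_side_generic assms(2) by blast
  show "R = {y. same_side x y}" using z assms(2) same_side_sym same_side_trans by blast
qed

lemma region_nonempty: "R \<in> regions (catalan_arr \<Phi> k) \<Longrightarrow> R \<noteq> {}"
  unfolding regions_iff using same_side_refl by blast

lemma region_open: "R \<in> regions (catalan_arr \<Phi> k) \<Longrightarrow> open R"
  unfolding regions_iff using open_same_side by blast

lemma region_convex: "R \<in> regions (catalan_arr \<Phi> k) \<Longrightarrow> convex R"
  unfolding regions_iff using convex_same_side by blast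

lemma region_side:
  assumes "R \<in> regions (catalan_arr \<Phi> k)" "x \<in> R" "y \<in> R" "\<alpha> \<in> \<Phi>" "\<bar>i\<bar> \<le> int k"
  shows "of_int i < x \<bullet> \<alpha> \<longleftrightarrow> of_int i < y \<bullet> \<alpha>"
  using region_eq(2)[OF assms(1,2)] assms(3-5) unfolding same_side_def by blast

end

section \<open>Walls\<close>

lemma eventually_step_in_open:
  fixes w d :: "'a::real_normed_vector"
  assumes "open U" "w \<in> U"
  shows "\<forall>\<^sub>F t in at_right (0::real). w + t *\<^sub>R d \<in> U"
proof -
  have "((\<lambda>t. w + t *\<^sub>R d) \<longlongrightarrow> w + 0 *\<^sub>R d) (at_right 0)"
    by (intro tendsto_intros)
  then show ?thesis using topological_tendstoD[of _ w "at_right 0" U] assms by simp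
qed

lemma hyp_subset_parallel:
  fixes \<alpha> \<beta> :: "'a::euclidean_space"
  assumes "hyp \<alpha> a \<subseteq> hyp \<beta> b" "\<alpha> \<noteq> 0"
  shows "\<exists>c. \<beta> = c *\<^sub>R \<alpha>"
proof -
  define d where "d = \<beta> - ((\<beta> \<bullet> \<alpha>) / (\<alpha> \<bullet> \<alpha>)) *\<^sub>R \<alpha>"
  have d: "d \<bullet> \<alpha> = 0" using assms(2) unfolding d_def by (simp add: inner_diff_left)
  define y where "y = (a / (\<alpha> \<bullet> \<alpha>)) *\<^sub>R \<alpha>"
  have "y \<in> hyp \<alpha> a" "y + d \<in> hyp \<alpha> a" using assms(2) d unfolding y_def hyp_def
    by (simp_all add: inner_add_left)
  then have "y \<in> hyp \<beta> b" "y + d \<in> hyp \<beta> b" using assms(1) by blast+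
  then have "d \<bullet> \<beta> = 0" unfolding hyp_def by (simp add: inner_add_left)
  then have "d \<bullet> d = 0" using d unfolding d_def by (simp add: inner_diff_right)
  then show ?thesis unfolding d_def by auto
qed

context root_arrangement
begin

text \<open>On \<open>closure R\<close> both \<open>y \<bullet> \<beta> - b\<close> and
  \<open>y \<bullet> \<gamma> - c\<close> are nonnegative, and on the wall their sum is 0, so the
  facet lies in \<open>hyp \<beta> b\<close> too. By dimension the facet spans its hyperplane, hence
  \<open>\<beta>\<close> is \<open>\<alpha>\<close> or \<open>- \<alpha>\<close>, leaving 0 or
  \<open>2 *\<^sub>R \<alpha>\<close> for \<open>\<gamma>\<close>. All indecomposability of walls
  comes from here.\<close>

lemma wall_not_sum:
  assumes R: "R \<in> regions (catalan_arr \<Phi> k)" and w: "wall (catalan_arr \<Phi> k) R (hyp \<alpha> (b + c))"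
    and r: "\<alpha> \<in> \<Phi>" "\<beta> \<in> \<Phi>" "\<gamma> \<in> \<Phi>" "\<alpha> = \<beta> + \<gamma>"
    and b: "\<And>y. y \<in> R \<Longrightarrow> y \<bullet> \<beta> > b" and c: "\<And>y. y \<in> R \<Longrightarrow> y \<bullet> \<gamma> > c"
  shows False
proof -
  define F where "F = closure R \<inter> hyp \<alpha> (b + c)"
  have fac: "F facet_of closure R" using w unfolding wall_def F_def by blast
  have cl: "y \<bullet> \<beta> \<ge> b" "y \<bullet> \<gamma> \<ge> c" if "y \<in> closure R" for y
  proof -
    have "closed {y. y \<bullet> \<beta> \<ge> b}" "closed {y. y \<bullet> \<gamma> \<ge> c}"
      using closed_halfspace_ge[of b \<beta>] closed_halfspace_ge[of c \<gamma>] by (simp_all add: inner_commute)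
    moreover have "R \<subseteq> {y. y \<bullet> \<beta> \<ge> b}" "R \<subseteq> {y. y \<bullet> \<gamma> \<ge> c}" using b c by (auto intro: less_imp_le)
    ultimately show "y \<bullet> \<beta> \<ge> b" "y \<bullet> \<gamma> \<ge> c" using closure_minimal that by blast+
  qed
  have sub: "F \<subseteq> hyp \<beta> b"
  proof
    fix y assume "y \<in> F"
    then have "y \<bullet> \<beta> \<ge> b" "y \<bullet> \<gamma> \<ge> c" "y \<bullet> \<alpha> = b + c" using cl unfolding F_def hyp_def by auto
    then show "y \<in> hyp \<beta> b" unfolding r(4) hyp_def by (simp add: inner_add_right)
  qed
  have "aff_dim F = aff_dim (closure R) - 1" using fac unfolding facet_of_def by blast
  also have "aff_dim (closure R) = DIM('a)"
    using aff_dim_open[OF region_open[OF R] region_nonempty[OF R]]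
      aff_dim_subset[OF closure_subset[of R]] aff_dim_le_DIM[of "closure R"] by simp
  finally have dF: "aff_dim F = DIM('a) - 1" using DIM_positive[where 'a = 'a] by (simp add: of_nat_diff)
  have hh: "hyp \<alpha> (b + c) = {x. \<alpha> \<bullet> x = b + c}" by (auto simp: hyp_def inner_commute)
  have "aff_dim (hyp \<alpha> (b + c)) = DIM('a) - 1"
    unfolding hh using aff_dim_hyperplane root_nonzero[OF r(1)] by blast
  then have "affine hull F = affine hull (hyp \<alpha> (b + c))"
    using aff_dim_eq_full_gen[of F "hyp \<alpha> (b + c)"] dF unfolding F_def by simp
  moreover have "affine (hyp \<alpha> (b + c))" unfolding hh by (rule affine_hyperplane)
  moreover have "affine (hyp \<beta> b)" using affine_hyperplane[of \<beta> b] by (simp add: hyp_def inner_commute)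
  ultimately have "hyp \<alpha> (b + c) \<subseteq> hyp \<beta> b"
    using sub hull_minimal[of F "hyp \<beta> b" affine] by (simp add: hull_same)
  then obtain t where t: "\<beta> = t *\<^sub>R \<alpha>" using hyp_subset_parallel root_nonzero[OF r(1)] by blast
  then consider "t = 1" | "t = -1" using root_scale r by blast
  then show False
  proof cases
    case 1
    then show False using t r root_nonzero[OF r(3)] by simp
  next
    case 2
    then have "\<gamma> = 2 *\<^sub>R \<alpha>" using t r(4) by (simp add: scaleR_2 algebra_simps)
    then show False using root_scale[OF r(1), of 2] r(3) by simp
  qed
qed

text \<open>Near \<open>z\<close> the region is one side of a single hyperplane, so an open piece of
  that hyperplane lies in \<open>closure R\<close> and the face has the dimension of a
  facet.\<close>

lemma wall_from_point:
  assumes R: "R \<in> regions (catalan_arr \<Phi> k)" and z: "z \<in> closure R" "z \<bullet> \<alpha> = of_int i"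
    and a: "\<alpha> \<in> \<Phi>" "\<bar>i\<bar> \<le> int k"
    and only: "\<And>\<beta> j. \<beta> \<in> \<Phi> \<Longrightarrow> \<bar>j\<bar> \<le> int k \<Longrightarrow> z \<bullet> \<beta> = of_int j \<Longrightarrow> \<beta> = \<alpha> \<and> j = i \<or> \<beta> = - \<alpha> \<and> j = - i"
  shows "wall (catalan_arr \<Phi> k) R (hyp \<alpha> (of_int i))"
proof -
  obtain x where xR: "x \<in> R" using region_nonempty[OF R] by blast
  have gx: "generic x" and Req: "R = {y. same_side x y}" using region_eq[OF R xR] by blast+
  have xai: "x \<bullet> \<alpha> \<noteq> of_int i" using gx a unfolding generic_def by blast
  \<comment> \<open>On \<open>U\<close> every affine root that is nonzero at \<open>z\<close> keeps
    its sign, so only the hyperplane through \<open>z\<close> decides membership in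
    \<open>R\<close>.\<close>
  define U where "U = (\<Inter>\<beta>\<in>\<Phi>. \<Inter>j\<in>{j\<in>{- int k..int k}. z \<bullet> \<beta> \<noteq> of_int j}.
      {w. if z \<bullet> \<beta> < of_int j then \<beta> \<bullet> w < of_int j else of_int j < \<beta> \<bullet> w})"
  have "open {w. if z \<bullet> \<beta> < of_int j then \<beta> \<bullet> w < of_int j else of_int j < \<beta> \<bullet> w}" for \<beta> and j :: int
    using open_halfspace_gt[of "of_int j" \<beta>] open_halfspace_lt[of \<beta> "of_int j"]
    by (cases "z \<bullet> \<beta> < of_int j") simp_all
  then have oU: "open U" unfolding U_def using finite_roots
    by (intro open_INT ballI) (auto intro: finite_subset[of _ "{- int k..int k}"])
  have zU: "z \<in> U" unfolding U_def by (auto simp: inner_commute)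
  have U: "of_int j < w \<bullet> \<beta> \<longleftrightarrow> of_int j < w' \<bullet> \<beta>"
    if "w \<in> U" "w' \<in> U" "\<beta> \<in> \<Phi>" "\<bar>j\<bar> \<le> int k" "z \<bullet> \<beta> \<noteq> of_int j" for w w' \<beta> j
  proof -
    have *: "if z \<bullet> \<beta> < of_int j then \<beta> \<bullet> w < of_int j else of_int j < \<beta> \<bullet> w" if "w \<in> U" for w
      using that \<open>\<beta> \<in> \<Phi>\<close> \<open>\<bar>j\<bar> \<le> int k\<close> \<open>z \<bullet> \<beta> \<noteq> of_int j\<close> unfolding U_def by (auto simp: abs_le_iff)
    show ?thesis using *[OF that(1)] *[OF that(2)] by (auto simp: inner_commute split: if_splits)
  qed
  obtain y where y: "y \<in> R" "y \<in> U" using z(1) oU zU closure_iff_nhds_not_empty by blast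
  have inR: "w \<in> R" if w: "w \<in> U" "w \<bullet> \<alpha> \<noteq> of_int i" "w \<bullet> \<alpha> < of_int i \<longleftrightarrow> x \<bullet> \<alpha> < of_int i" for w
  proof -
    have "of_int j < x \<bullet> \<beta> \<longleftrightarrow> of_int j < w \<bullet> \<beta>" if b: "\<beta> \<in> \<Phi>" "\<bar>j\<bar> \<le> int k" for \<beta> j
    proof (cases "z \<bullet> \<beta> = of_int j")
      case True
      then consider "\<beta> = \<alpha>" "j = i" | "\<beta> = - \<alpha>" "j = - i" using only[OF b] by blast
      then show ?thesis using w xai by cases auto
    next
      case False
      then have "of_int j < y \<bullet> \<beta> \<longleftrightarrow> of_int j < w \<bullet> \<beta>" using U[OF y(2) w(1)] b by blast
      then show ?thesis using region_side[OF R xR y(1) b] by blast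
    qed
    then show ?thesis unfolding Req same_side_def by blast
  qed
  define H where "H = hyp \<alpha> (of_int i)"
  have sub: "H \<inter> U \<subseteq> closure R \<inter> H"
  proof
    fix w assume w: "w \<in> H \<inter> U"
    have "w \<in> closure R"
    proof (rule ccontr)
      \<comment> \<open>A short step from \<open>w\<close> towards \<open>x\<close> stays in
        \<open>U\<close> and leaves \<open>H\<close> on the side of \<open>x\<close>, hence lands in
        \<open>R\<close>.\<close>
      assume "w \<notin> closure R"
      then have "w \<in> U \<inter> - closure R" "open (U \<inter> - closure R)" using w oU by auto
      then have "\<forall>\<^sub>F t in at_right (0::real). w + t *\<^sub>R (x - w) \<in> U \<inter> - closure R"
        using eventually_step_in_open by blast
      then have "\<forall>\<^sub>F t in at_right (0::real). 0 < t \<and> w + t *\<^sub>R (x - w) \<in> U \<inter> - closure R"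
        using eventually_at_right_less[of 0] by eventually_elim auto
      then obtain t :: real where t: "0 < t" "w + t *\<^sub>R (x - w) \<in> U" "w + t *\<^sub>R (x - w) \<notin> closure R"
        using eventually_happens'[OF trivial_limit_at_right_real] by blast
      have "(w + t *\<^sub>R (x - w)) \<bullet> \<alpha> = of_int i + t * (x \<bullet> \<alpha> - of_int i)"
        using w unfolding H_def hyp_def by (simp add: inner_add_left inner_diff_left)
      then have "w + t *\<^sub>R (x - w) \<in> R" using inR[OF t(2)] xai t(1)
        by (auto simp: mult_less_0_iff)
      then show False using t(3) closure_subset by blast
    qed
    then show "w \<in> closure R \<inter> H" using w by blast
  qed
  have hh: "H = {x. \<alpha> \<bullet> x = of_int i}" by (auto simp: H_def hyp_def inner_commute)
  have dH: "aff_dim H = DIM('a) - 1" unfolding hh using aff_dim_hyperplane root_nonzero[OF a(1)] by blast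
  have "z \<in> H \<inter> U" using zU z(2) unfolding H_def hyp_def by simp
  moreover have "convex H" unfolding hh by (rule convex_hyperplane)
  ultimately have "aff_dim (H \<inter> U) = DIM('a) - 1" using aff_dim_convex_Int_open[of H U] oU dH by auto
  then have "aff_dim (closure R \<inter> H) = DIM('a) - 1"
    using aff_dim_subset[OF sub] aff_dim_subset[of "closure R \<inter> H" H] dH by auto
  moreover have "aff_dim (closure R) = DIM('a)"
    using aff_dim_open[OF region_open[OF R] region_nonempty[OF R]]
      aff_dim_subset[OF closure_subset[of R]] aff_dim_le_DIM[of "closure R"] by simp
  moreover have "(closure R \<inter> H) face_of closure R"
  proof -
    have cv: "convex (closure R)" using region_convex[OF R] by (rule convex_closure)
    show ?thesis
    proof (cases "x \<bullet> \<alpha> < of_int i")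
      case True
      have "R \<subseteq> {y. \<alpha> \<bullet> y \<le> of_int i}"
        using region_side[OF R xR _ a] True by (force simp: inner_commute)
      then have "closure R \<subseteq> {y. \<alpha> \<bullet> y \<le> of_int i}" by (intro closure_minimal closed_halfspace_le)
      then show ?thesis unfolding hh by (intro face_of_Int_supporting_hyperplane_le cv) auto
    next
      case False
      then have "of_int i < x \<bullet> \<alpha>" using xai by auto
      then have "R \<subseteq> {y. \<alpha> \<bullet> y \<ge> of_int i}"
        using region_side[OF R xR _ a] by (force simp: inner_commute)
      then have "closure R \<subseteq> {y. \<alpha> \<bullet> y \<ge> of_int i}" by (intro closure_minimal closed_halfspace_ge)
      then show ?thesis unfolding hh by (intro face_of_Int_supporting_hyperplane_ge cv) auto
    qed
  qed
  moreover have "closure R \<inter> H \<noteq> {}" using sub \<open>z \<in> H \<inter> U\<close> by blast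
  ultimately have "(closure R \<inter> H) facet_of closure R" unfolding facet_of_def by auto
  moreover have "H \<in> catalan_arr \<Phi> k" unfolding H_def mem_arr_iff using a by blast
  ultimately show ?thesis unfolding wall_def H_def by blast
qed

end

section \<open>Crossing a face\<close>

context root_arrangement
begin

text \<open>For empty \<open>M\<close> the set \<open>L\<close> is the whole space, which lies in no
  hyperplane, and between regions the relation becomes equality.\<close>

definition crossing :: "'a set \<Rightarrow> 'a set \<Rightarrow> 'a set \<Rightarrow> bool" where
  "crossing L R R' \<longleftrightarrow> (\<forall>y\<in>R. \<forall>z\<in>R'. \<forall>\<alpha>\<in>\<Phi>. \<forall>i::int. \<bar>i\<bar> \<le> int k \<longrightarrow>
     ((of_int i < y \<bullet> \<alpha> \<longleftrightarrow> of_int i < z \<bullet> \<alpha>) \<longleftrightarrow> \<not> L \<subseteq> hyp \<alpha> (of_int i)))"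

lemma crossing_sym: "crossing L R R' \<Longrightarrow> crossing L R' R"
  unfolding crossing_def by metis

lemma crossing_unique:
  assumes "R \<in> regions (catalan_arr \<Phi> k)" "R1 \<in> regions (catalan_arr \<Phi> k)" "R2 \<in> regions (catalan_arr \<Phi> k)"
    and "crossing L R R1" "crossing L R R2"
  shows "R1 = R2"
proof -
  obtain x y z where xyz: "x \<in> R" "y \<in> R1" "z \<in> R2" using assms(1-3)[THEN region_nonempty] by auto
  have "of_int i < y \<bullet> \<alpha> \<longleftrightarrow> of_int i < z \<bullet> \<alpha>" if a: "\<alpha> \<in> \<Phi>" "\<bar>i\<bar> \<le> int k" for \<alpha> i
    using assms(4)[unfolded crossing_def, rule_format, OF xyz(1,2) a]
      assms(5)[unfolded crossing_def, rule_format, OF xyz(1,3) a] by argo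
  then have "same_side y z" unfolding same_side_def by blast
  then show ?thesis using region_eq(2)[OF assms(2) xyz(2)] region_eq(2)[OF assms(3) xyz(3)]
    same_side_sym same_side_trans by blast
qed

text \<open>A local computation at the point \<open>p\<close> of the face. By \<open>cone\<close>,
  an affine root positive at \<open>x\<close> and zero at \<open>p\<close> is a nonnegative
  combination of those given by \<open>S\<close>, so a short step from \<open>p\<close> against the
  dual vectors makes all of these negative at once and keeps the sign of the others.\<close>

lemma opposite_region:
  fixes \<kappa> :: "'a \<Rightarrow> int" and u :: "'a \<Rightarrow> 'a"
  assumes R: "R \<in> regions (catalan_arr \<Phi> k)" and xR: "x \<in> R"
    and S: "S \<subseteq> \<Phi>"
    and u: "\<And>a b. a \<in> S \<Longrightarrow> b \<in> S \<Longrightarrow> u a \<bullet> b = (if a = b then 1 else 0)"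
    and \<kappa>: "\<And>b. b \<in> S \<Longrightarrow> \<bar>\<kappa> b\<bar> \<le> int k" "\<And>b. b \<in> S \<Longrightarrow> p \<bullet> b = of_int (\<kappa> b)"
      "\<And>b. b \<in> S \<Longrightarrow> of_int (\<kappa> b) < x \<bullet> b"
    and p: "\<And>\<gamma> i. \<gamma> \<in> \<Phi> \<Longrightarrow> \<bar>i\<bar> \<le> int k \<Longrightarrow> of_int i < x \<bullet> \<gamma> \<Longrightarrow> of_int i \<le> p \<bullet> \<gamma>"
    and cone: "\<And>\<gamma> i. \<gamma> \<in> \<Phi> \<Longrightarrow> \<bar>i\<bar> \<le> int k \<Longrightarrow> of_int i < x \<bullet> \<gamma> \<Longrightarrow> p \<bullet> \<gamma> = of_int i \<Longrightarrow>
      \<exists>c::'a\<Rightarrow>real. (\<forall>b\<in>S. c b \<ge> 0) \<and> \<gamma> = (\<Sum>b\<in>S. c b *\<^sub>R b) \<and> of_int i = (\<Sum>b\<in>S. c b * of_int (\<kappa> b))"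
    and dom: "dominant pos R" and sgn: "(\<forall>b\<in>S. \<kappa> b > 0) \<or> (\<forall>b\<in>S. \<kappa> b < 0)"
  shows "\<exists>R'\<in>regions (catalan_arr \<Phi> k). dominant pos R' \<and>
    crossing {y. \<forall>b\<in>S. y \<bullet> b = of_int (\<kappa> b)} R R' \<and>
    (\<forall>b\<in>S. wall (catalan_arr \<Phi> k) R' (hyp b (of_int (\<kappa> b))) \<and> (\<forall>y\<in>R'. y \<bullet> b < of_int (\<kappa> b)))"
proof -
  define L where "L = {y. \<forall>b\<in>S. y \<bullet> b = of_int (\<kappa> b)}"
  have fS: "finite S" using S finite_roots finite_subset by blast
  have pL: "p \<in> L" using \<kappa>(2) unfolding L_def by blast
  have gx: "generic x" using region_eq(1)[OF R xR] .
  \<comment> \<open>Here the affine roots positive at \<open>p\<close> stay positive; those negative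
    at \<open>p\<close> are covered through their negatives.\<close>
  define U where "U = (\<Inter>\<gamma>\<in>\<Phi>. \<Inter>i\<in>{i\<in>{- int k..int k}. of_int i < p \<bullet> \<gamma>}. {w. \<gamma> \<bullet> w > of_int i})"
  have oU: "open U" unfolding U_def using finite_roots open_halfspace_gt
    by (intro open_INT ballI) (auto intro: finite_subset[of _ "{- int k..int k}"])
  have cU: "convex U" unfolding U_def by (intro convex_INT convex_halfspace_gt)
  have pU: "p \<in> U" unfolding U_def by (auto simp: inner_commute)
  have U: "of_int i < w \<bullet> \<gamma>" if "w \<in> U" "\<gamma> \<in> \<Phi>" "\<bar>i\<bar> \<le> int k" "of_int i < p \<bullet> \<gamma>" for w \<gamma> i
    using that unfolding U_def by (auto simp: inner_commute abs_le_iff)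
  define P where "P = (\<lambda>s. p - (\<Sum>b\<in>S. s b *\<^sub>R u b))"
  have uc: "u a \<bullet> (\<Sum>b\<in>S. c b *\<^sub>R b) = c a" if "a \<in> S" for a c
  proof -
    have "u a \<bullet> (\<Sum>b\<in>S. c b *\<^sub>R b) = (\<Sum>b\<in>S. if a = b then c b else 0)"
      unfolding inner_sum_right by (rule sum.cong) (use u that in auto)
    then show ?thesis using fS that by simp
  qed
  have Pc: "P s \<bullet> (\<Sum>b\<in>S. c b *\<^sub>R b) = p \<bullet> (\<Sum>b\<in>S. c b *\<^sub>R b) - (\<Sum>b\<in>S. s b * c b)" for s c
    unfolding P_def inner_diff_left inner_sum_left using uc by simp
  have Pb: "P s \<bullet> b = of_int (\<kappa> b) - s b" if "b \<in> S" for s b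
  proof -
    have "(\<Sum>a\<in>S. s a *\<^sub>R u a) \<bullet> b = (\<Sum>a\<in>S. if b = a then s a else 0)"
      unfolding inner_sum_left by (rule sum.cong) (use u that in auto)
    then show ?thesis using \<kappa>(2)[OF that] fS that unfolding P_def inner_diff_left by simp
  qed
  \<comment> \<open>The coefficient 0 at \<open>b\<close> puts \<open>z b\<close> on the hyperplane
    of \<open>b\<close>, strictly beyond those of the other members of \<open>S\<close>: a point to
    which \<open>wall_from_point\<close> will apply.\<close>
  define s1 where "s1 = (\<lambda>(e::real) (b::'a) (a::'a). if a = b then 0 else e)"
  have "\<forall>\<^sub>F e in at_right (0::real). p + e *\<^sub>R (- (\<Sum>b\<in>S. u b)) \<in> U"
    by (rule eventually_step_in_open[OF oU pU])
  moreover have "\<forall>\<^sub>F e in at_right (0::real). \<forall>b\<in>S. p + e *\<^sub>R (- (\<Sum>a\<in>S. s1 1 b a *\<^sub>R u a)) \<in> U"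
    by (intro eventually_ball_finite[OF fS] ballI eventually_step_in_open[OF oU pU])
  ultimately have "\<forall>\<^sub>F e in at_right (0::real). 0 < e \<and> p + e *\<^sub>R (- (\<Sum>b\<in>S. u b)) \<in> U \<and>
      (\<forall>b\<in>S. p + e *\<^sub>R (- (\<Sum>a\<in>S. s1 1 b a *\<^sub>R u a)) \<in> U)"
    using eventually_at_right_less[of "0::real"] by eventually_elim auto
  then obtain e :: real where e: "0 < e" "p + e *\<^sub>R (- (\<Sum>b\<in>S. u b)) \<in> U"
      "\<And>b. b \<in> S \<Longrightarrow> p + e *\<^sub>R (- (\<Sum>a\<in>S. s1 1 b a *\<^sub>R u a)) \<in> U"
    using eventually_happens'[OF trivial_limit_at_right_real] by blast
  define q where "q = P (\<lambda>_. e)"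
  define z where "z = (\<lambda>b. P (s1 e b))"
  have qU: "q \<in> U" using e(2) unfolding q_def P_def by (simp add: scaleR_sum_right)
  have zU: "z b \<in> U" if "b \<in> S" for b
  proof -
    have "e *\<^sub>R (\<Sum>a\<in>S. s1 1 b a *\<^sub>R u a) = (\<Sum>a\<in>S. s1 e b a *\<^sub>R u a)"
      unfolding scaleR_sum_right by (rule sum.cong) (auto simp: s1_def)
    then show ?thesis using e(3)[OF that] unfolding z_def P_def by simp
  qed
  have inL: "L \<subseteq> hyp \<gamma> (of_int i) \<longleftrightarrow> p \<bullet> \<gamma> = of_int i"
    if g: "\<gamma> \<in> \<Phi>" "\<bar>i\<bar> \<le> int k" "of_int i < x \<bullet> \<gamma>" for \<gamma> i
  proof
    assume "L \<subseteq> hyp \<gamma> (of_int i)" then show "p \<bullet> \<gamma> = of_int i" using pL unfolding hyp_def by auto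
  next
    assume "p \<bullet> \<gamma> = of_int i"
    then obtain c :: "'a \<Rightarrow> real" where c: "\<gamma> = (\<Sum>b\<in>S. c b *\<^sub>R b)" "of_int i = (\<Sum>b\<in>S. c b * of_int (\<kappa> b))"
      using cone[OF g] by blast
    show "L \<subseteq> hyp \<gamma> (of_int i)" unfolding L_def hyp_def c(1) c(2) by (auto simp: inner_sum_right)
  qed
  have strict: "of_int i < p \<bullet> \<gamma> \<or> p \<bullet> \<gamma> = of_int i" if "\<gamma> \<in> \<Phi>" "\<bar>i\<bar> \<le> int k" "of_int i < x \<bullet> \<gamma>" for \<gamma> i
    using p[OF that] by linarith
  have Ppos: "P s \<bullet> \<gamma> < of_int i"
    if g: "\<gamma> \<in> \<Phi>" "\<bar>i\<bar> \<le> int k" "of_int i < x \<bullet> \<gamma>" "p \<bullet> \<gamma> = of_int i" and s: "\<And>b. b \<in> S \<Longrightarrow> s b > 0" for \<gamma> i s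
  proof -
    obtain c :: "'a \<Rightarrow> real" where c: "\<forall>b\<in>S. c b \<ge> 0" "\<gamma> = (\<Sum>b\<in>S. c b *\<^sub>R b)"
      using cone[OF g] by blast
    have "\<exists>a\<in>S. c a \<noteq> 0"
    proof (rule ccontr)
      assume "\<not> ?thesis" then have "\<gamma> = 0" unfolding c(2) by simp
      then show False using root_nonzero g(1) by blast
    qed
    then obtain a where a: "a \<in> S" "c a \<noteq> 0" by blast
    have "(\<Sum>b\<in>S. s b * c b) > 0"
      by (rule sum_pos2[OF fS a(1)]) (use a c(1) s in \<open>auto intro!: mult_pos_pos mult_nonneg_nonneg less_imp_le simp: order_less_le\<close>)
    then show ?thesis using Pc[of s c] g(4) unfolding c(2)[symmetric] by linarith
  qed
  have side: "(p \<bullet> \<gamma> \<noteq> of_int i \<longrightarrow> of_int i < P s \<bullet> \<gamma>) \<and> (p \<bullet> \<gamma> = of_int i \<longrightarrow> P s \<bullet> \<gamma> < of_int i)"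
    if g: "\<gamma> \<in> \<Phi>" "\<bar>i\<bar> \<le> int k" "of_int i < x \<bullet> \<gamma>" and s: "\<And>b. b \<in> S \<Longrightarrow> s b > 0" "P s \<in> U" for \<gamma> i s
    using Ppos[OF g _ s(1)] strict[OF g] U[OF s(2) g(1,2)] by auto
  have side': "(L \<subseteq> hyp \<gamma> (of_int i) \<longrightarrow> (of_int i < P s \<bullet> \<gamma>) = (\<not> of_int i < x \<bullet> \<gamma>)) \<and>
      (\<not> L \<subseteq> hyp \<gamma> (of_int i) \<longrightarrow> (of_int i < P s \<bullet> \<gamma>) = (of_int i < x \<bullet> \<gamma>)) \<and> P s \<bullet> \<gamma> \<noteq> of_int i"
    if g: "\<gamma> \<in> \<Phi>" "\<bar>i\<bar> \<le> int k" and s: "\<And>b. b \<in> S \<Longrightarrow> s b > 0" "P s \<in> U" for \<gamma> i s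
  proof (cases "of_int i < x \<bullet> \<gamma>")
    case True
    then show ?thesis using side[OF g True s] inL[OF g True] by auto
  next
    case False
    \<comment> \<open>An affine root negative at \<open>x\<close> is replaced by its negative, which
      has the same hyperplane.\<close>
    have m: "- \<gamma> \<in> \<Phi>" "\<bar>- i\<bar> \<le> int k" "of_int (- i) < x \<bullet> (- \<gamma>)"
      using g root_uminus[OF crys] False gx[unfolded generic_def, rule_format, OF g(1,2)] by auto
    have hm: "hyp (- \<gamma>) (of_int (- i)) = hyp \<gamma> (of_int i)" unfolding hyp_def by auto
    show ?thesis using side[OF m s] inL[OF m] False unfolding hm by auto
  qed
  have q: "(L \<subseteq> hyp \<gamma> (of_int i) \<longrightarrow> (of_int i < q \<bullet> \<gamma>) = (\<not> of_int i < x \<bullet> \<gamma>)) \<and>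
      (\<not> L \<subseteq> hyp \<gamma> (of_int i) \<longrightarrow> (of_int i < q \<bullet> \<gamma>) = (of_int i < x \<bullet> \<gamma>)) \<and> q \<bullet> \<gamma> \<noteq> of_int i"
    if g: "\<gamma> \<in> \<Phi>" "\<bar>i\<bar> \<le> int k" for \<gamma> i
    using side'[OF g, of "\<lambda>_. e"] e(1) qU unfolding q_def by blast
  have gq: "generic q" using q unfolding generic_def by blast
  define R' where "R' = {y. same_side q y}"
  have R': "R' \<in> regions (catalan_arr \<Phi> k)" unfolding R'_def regions_iff using gq by blast
  have qR': "q \<in> R'" unfolding R'_def using same_side_refl by blast
  have inR': "P s \<in> R'" if s: "\<And>b. b \<in> S \<Longrightarrow> s b > 0" "P s \<in> U" for s
    unfolding R'_def same_side_def using side'[OF _ _ s] q by blast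
  have cr: "crossing L R R'" unfolding crossing_def
  proof (intro ballI allI impI)
    fix y y' \<alpha> i assume h: "y \<in> R" "y' \<in> R'" "\<alpha> \<in> \<Phi>" "\<bar>i\<bar> \<le> int k"
    show "(of_int i < y \<bullet> \<alpha> \<longleftrightarrow> of_int i < y' \<bullet> \<alpha>) \<longleftrightarrow> \<not> L \<subseteq> hyp \<alpha> (of_int i)"
      using region_side[OF R xR h(1,3,4)] region_side[OF R' qR' h(2-4)] q[OF h(3,4)] by blast
  qed
  have dR': "dominant pos R'" unfolding dominant_def
  proof (intro ballI)
    fix y \<gamma> assume y: "y \<in> R'" and g: "\<gamma> \<in> pos"
    then have g': "\<gamma> \<in> \<Phi>" "\<bar>0\<bar> \<le> int k" "of_int 0 < x \<bullet> \<gamma>" using dom xR unfolding pos_def dominant_def by auto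
    have "p \<bullet> \<gamma> \<noteq> of_int 0"
    proof
      assume "p \<bullet> \<gamma> = of_int 0"
      then obtain c :: "'a \<Rightarrow> real" where c: "\<forall>b\<in>S. c b \<ge> 0" "\<gamma> = (\<Sum>b\<in>S. c b *\<^sub>R b)"
          "0 = (\<Sum>b\<in>S. c b * of_int (\<kappa> b))" using cone[OF g'] by auto
      \<comment> \<open>The common sign of the levels excludes cancellation, so a combination of
        level 0 has all coefficients 0. Hence no hyperplane through the origin is crossed and
        dominance survives.\<close>
      have "(\<Sum>b\<in>S. c b * \<bar>of_int (\<kappa> b)\<bar>) = 0"
        using sgn
      proof
        assume "\<forall>b\<in>S. \<kappa> b > 0"
        then have "(\<Sum>b\<in>S. c b * \<bar>of_int (\<kappa> b)\<bar>) = (\<Sum>b\<in>S. c b * of_int (\<kappa> b))"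
          by (intro sum.cong) auto
        then show ?thesis using c(3) by simp
      next
        assume "\<forall>b\<in>S. \<kappa> b < 0"
        then have "(\<Sum>b\<in>S. c b * \<bar>of_int (\<kappa> b)\<bar>) = (\<Sum>b\<in>S. - (c b * of_int (\<kappa> b)))"
          by (intro sum.cong) auto
        then show ?thesis using c(3) by (simp add: sum_negf)
      qed
      moreover have "c b * \<bar>of_int (\<kappa> b)\<bar> \<ge> 0" if "b \<in> S" for b using c(1) that by auto
      ultimately have "c b * \<bar>of_int (\<kappa> b)\<bar> = 0" if "b \<in> S" for b
        using sum_nonneg_eq_0_iff[OF fS, of "\<lambda>b. c b * \<bar>of_int (\<kappa> b)\<bar>"] that by blast
      then have "c b = 0" if "b \<in> S" for b using sgn that by fastforce
      then have "\<gamma> = 0" unfolding c(2) by simp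
      then show False using root_nonzero g' by blast
    qed
    then have "of_int 0 < q \<bullet> \<gamma>" using q[OF g'(1,2)] inL[OF g'] g'(3) by blast
    then show "0 < y \<bullet> \<gamma>" using region_side[OF R' qR' y g'(1,2)] by simp
  qed
  have "wall (catalan_arr \<Phi> k) R' (hyp b (of_int (\<kappa> b)))" if b: "b \<in> S" for b
  proof (rule wall_from_point[OF R', of "z b"])
    show "z b \<in> closure R'"
    proof (rule ccontr)
      assume "z b \<notin> closure R'"
      then have "\<forall>\<^sub>F t in at_right (0::real). z b + t *\<^sub>R (q - z b) \<in> - closure R'"
        by (intro eventually_step_in_open) auto
      then have "\<forall>\<^sub>F t in at_right (0::real). 0 < t \<and> t < 1 \<and> z b + t *\<^sub>R (q - z b) \<in> - closure R'"
        using eventually_at_right_less[of "0::real"] eventually_at_right_real[of 0 "1::real"]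
        by (auto elim: eventually_elim2)
      then obtain t :: real where t: "0 < t" "t < 1" "z b + t *\<^sub>R (q - z b) \<notin> closure R'"
        using eventually_happens'[OF trivial_limit_at_right_real] by blast
      \<comment> \<open>Along the segment from \<open>z b\<close> to \<open>q\<close> only the
        coefficient at \<open>b\<close> varies, from 0 to \<open>e\<close>; it is positive as soon
        as \<open>t > 0\<close>, which places the point in \<open>R'\<close>.\<close>
      define s where "s = (\<lambda>a. if a = b then t * e else e)"
      have Ps: "z b + t *\<^sub>R (q - z b) = P s"
      proof -
        define A where "A = (\<Sum>a\<in>S. s1 e b a *\<^sub>R u a)"
        define B where "B = (\<Sum>a\<in>S. e *\<^sub>R u a)"
        have "(\<Sum>a\<in>S. s a *\<^sub>R u a) = (1 - t) *\<^sub>R A + t *\<^sub>R B"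
          unfolding A_def B_def scaleR_sum_right sum.distrib[symmetric]
          by (rule sum.cong) (auto simp: s_def s1_def algebra_simps)
        then show ?thesis unfolding z_def q_def P_def A_def[symmetric] B_def[symmetric]
          by (simp add: algebra_simps)
      qed
      have "z b + t *\<^sub>R (q - z b) = (1 - t) *\<^sub>R z b + t *\<^sub>R q" by (simp add: algebra_simps)
      then have "P s \<in> U" unfolding Ps[symmetric] using convexD[OF cU zU[OF b] qU, of "1 - t" t] t by simp
      then have "P s \<in> R'" using t e(1) by (intro inR') (auto simp: s_def)
      then show False using t(3) closure_subset unfolding Ps by blast
    qed
    show "z b \<bullet> b = of_int (\<kappa> b)" unfolding z_def using Pb[OF b] by (simp add: s1_def)
    show "b \<in> \<Phi>" "\<bar>\<kappa> b\<bar> \<le> int k" using b S \<kappa>(1) by auto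
    have *: "\<gamma> = b \<and> j = \<kappa> b"
      if g: "\<gamma> \<in> \<Phi>" "\<bar>j\<bar> \<le> int k" "of_int j < x \<bullet> \<gamma>" "z b \<bullet> \<gamma> = of_int j" for \<gamma> j
    proof -
      have pj: "p \<bullet> \<gamma> = of_int j" using strict[OF g(1-3)] U[OF zU[OF b] g(1,2)] g(4) by auto
      obtain c :: "'a \<Rightarrow> real" where c: "\<forall>b\<in>S. c b \<ge> 0" "\<gamma> = (\<Sum>b\<in>S. c b *\<^sub>R b)"
          "of_int j = (\<Sum>b\<in>S. c b * of_int (\<kappa> b))" using cone[OF g(1-3) pj] by auto
      have "(\<Sum>a\<in>S. s1 e b a * c a) = 0" using Pc[of "s1 e b" c] g(4) pj unfolding c(2)[symmetric] z_def by simp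
      moreover have "s1 e b a * c a \<ge> 0" if "a \<in> S" for a using c(1) e(1) that unfolding s1_def by auto
      ultimately have "s1 e b a * c a = 0" if "a \<in> S" for a
        using sum_nonneg_eq_0_iff[OF fS, of "\<lambda>a. s1 e b a * c a"] that by blast
      then have c0: "c a = 0" if "a \<in> S" "a \<noteq> b" for a using e(1) that unfolding s1_def by fastforce
      have "\<gamma> = (\<Sum>a\<in>S. if b = a then c a *\<^sub>R a else 0)" unfolding c(2) by (rule sum.cong) (use c0 in auto)
      then have gb: "\<gamma> = c b *\<^sub>R b" using fS b by simp
      have "c b = 1 \<or> c b = -1" using root_scale[of b "c b"] g(1) gb S b by auto
      then have cb: "c b = 1" using c(1) b by auto
      have "(\<Sum>a\<in>S. c a * of_int (\<kappa> a)) = (\<Sum>a\<in>S. if b = a then c a * of_int (\<kappa> a) else 0)"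
        by (rule sum.cong) (use c0 in auto)
      then have "of_int j = c b * of_int (\<kappa> b)" using fS b c(3) by simp
      then show ?thesis using gb cb by simp
    qed
    fix \<gamma> j assume g: "\<gamma> \<in> \<Phi>" "\<bar>j\<bar> \<le> int k" "z b \<bullet> \<gamma> = of_int j"
    show "\<gamma> = b \<and> j = \<kappa> b \<or> \<gamma> = - b \<and> j = - \<kappa> b"
    proof (cases "of_int j < x \<bullet> \<gamma>")
      case True then show ?thesis using * g by blast
    next
      case False
      have m: "- \<gamma> \<in> \<Phi>" "\<bar>- j\<bar> \<le> int k" "of_int (- j) < x \<bullet> (- \<gamma>)" "z b \<bullet> (- \<gamma>) = of_int (- j)"
        using g root_uminus[OF crys] False gx[unfolded generic_def, rule_format, OF g(1,2)] by auto
      show ?thesis using *[OF m] by auto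
    qed
  qed
  moreover have "y \<bullet> b < of_int (\<kappa> b)" if "b \<in> S" "y \<in> R'" for b y
  proof -
    have "q \<bullet> b < of_int (\<kappa> b)" using Pb[OF that(1)] e(1) unfolding q_def by simp
    then show ?thesis using same_side_less[OF gq, of y b "\<kappa> b"] that S \<kappa>(1) unfolding R'_def by blast
  qed
  ultimately show ?thesis using R' dR' cr unfolding L_def by blast
qed

end

section \<open>Alcoves\<close>

lemma floor_add_cases:
  fixes a b :: real
  shows "\<lfloor>a + b\<rfloor> = \<lfloor>a\<rfloor> + \<lfloor>b\<rfloor> \<or> \<lfloor>a + b\<rfloor> = \<lfloor>a\<rfloor> + \<lfloor>b\<rfloor> + 1"
  by linarith

lemma floor_uminus_nonint:
  fixes a :: real
  assumes "a \<notin> \<int>"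
  shows "\<lfloor>- a\<rfloor> = - \<lfloor>a\<rfloor> - 1"
proof -
  have "a \<noteq> of_int \<lfloor>a\<rfloor>" using assms Ints_of_int by metis
  then show ?thesis by linarith
qed

context root_arrangement
begin

text \<open>Used with \<open>\<Phi>\<close> for floors and with \<open>bounded_roots R\<close> for
  ceilings; closure keeps the difference of two distinct members with positive inner product
  inside.\<close>

definition subsystem :: "'a set \<Rightarrow> bool" where
  "subsystem \<Psi> \<longleftrightarrow> \<Psi> \<subseteq> \<Phi> \<and> (\<forall>\<alpha>\<in>\<Psi>. - \<alpha> \<in> \<Psi>) \<and> (\<forall>\<alpha>\<in>\<Psi>. \<forall>\<beta>\<in>\<Psi>. \<alpha> + \<beta> \<in> \<Phi> \<longrightarrow> \<alpha> + \<beta> \<in> \<Psi>)"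

definition nonint :: "'a set \<Rightarrow> 'a \<Rightarrow> bool" where
  "nonint \<Psi> x \<longleftrightarrow> (\<forall>\<alpha>\<in>\<Psi>. x \<bullet> \<alpha> \<notin> \<int>)"

text \<open>
  The numbers \<open>\<lfloor>x \<bullet> \<beta>\<rfloor>\<close> record the alcove of \<open>x\<close>. The affine root \<open>\<alpha> - \<lfloor>x \<bullet> \<alpha>\<rfloor>\<close> is a sum of two affine
  roots positive on the alcove iff \<open>\<alpha>\<close> is decomposable; the indecomposable \<open>\<alpha>\<close> are the inner normals
  of its walls.
\<close>

definition decomposable :: "'a set \<Rightarrow> 'a \<Rightarrow> 'a \<Rightarrow> bool" where
  "decomposable \<Psi> x \<alpha> \<longleftrightarrow> (\<exists>\<mu>\<in>\<Psi>. \<exists>\<nu>\<in>\<Psi>. \<alpha> = \<mu> + \<nu> \<and> \<lfloor>x \<bullet> \<alpha>\<rfloor> = \<lfloor>x \<bullet> \<mu>\<rfloor> + \<lfloor>x \<bullet> \<nu>\<rfloor>)"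

lemma decomposable_cong:
  assumes "\<And>\<beta>. \<beta> \<in> \<Psi> \<Longrightarrow> \<lfloor>x' \<bullet> \<beta>\<rfloor> = \<lfloor>x \<bullet> \<beta>\<rfloor>" "\<alpha> \<in> \<Psi>"
  shows "decomposable \<Psi> x' \<alpha> \<longleftrightarrow> decomposable \<Psi> x \<alpha>"
  unfolding decomposable_def using assms by auto

lemma subsystem_diff:
  assumes "subsystem \<Psi>" "\<alpha> \<in> \<Psi>" "\<beta> \<in> \<Psi>" "\<alpha> \<noteq> \<beta>" "\<alpha> \<bullet> \<beta> > 0"
  shows "\<alpha> - \<beta> \<in> \<Psi>"
proof -
  have "\<alpha> \<in> \<Phi>" "\<beta> \<in> \<Phi>" "- \<beta> \<in> \<Psi>" using assms(1-3) unfolding subsystem_def by auto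
  moreover from this have "\<alpha> + - \<beta> \<in> \<Phi>" using root_diff[OF crys _ _ assms(4,5)] by simp
  ultimately have "\<alpha> + - \<beta> \<in> \<Psi>" using assms(1,2) unfolding subsystem_def by blast
  then show ?thesis by simp
qed

section \<open>Levels of roots on an alcove and its indecomposable roots\<close>

lemma floor_root_add: "\<lfloor>x \<bullet> (\<alpha> + \<beta>)\<rfloor> = \<lfloor>x \<bullet> \<alpha>\<rfloor> + \<lfloor>x \<bullet> \<beta>\<rfloor> \<or> \<lfloor>x \<bullet> (\<alpha> + \<beta>)\<rfloor> = \<lfloor>x \<bullet> \<alpha>\<rfloor> + \<lfloor>x \<bullet> \<beta>\<rfloor> + 1"
  unfolding inner_add_right by (rule floor_add_cases)

lemma floor_root_uminus: "nonint \<Psi> x \<Longrightarrow> \<alpha> \<in> \<Psi> \<Longrightarrow> \<lfloor>x \<bullet> (- \<alpha>)\<rfloor> = - \<lfloor>x \<bullet> \<alpha>\<rfloor> - 1"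
  unfolding nonint_def inner_minus_right using floor_uminus_nonint by blast

text \<open>With a positive inner product \<open>\<alpha> - \<beta>\<close> is a root. If the levels
  in \<open>\<alpha> = \<beta> + (\<alpha> - \<beta>)\<close> add up exactly,
  \<open>\<alpha>\<close> decomposes; if there is a carry 1, negation absorbs it and
  \<open>\<beta> = \<alpha> + (- (\<alpha> - \<beta>))\<close> decomposes.\<close>

lemma indecomposable_obtuse:
  assumes P: "subsystem \<Psi>" "nonint \<Psi> x" and ab: "\<alpha> \<in> \<Psi>" "\<beta> \<in> \<Psi>" "\<alpha> \<noteq> \<beta>"
    and n: "\<not> decomposable \<Psi> x \<alpha>" "\<not> decomposable \<Psi> x \<beta>"
  shows "\<alpha> \<bullet> \<beta> \<le> 0"
proof (rule ccontr)
  assume "\<not> ?thesis"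
  then have d: "\<alpha> - \<beta> \<in> \<Psi>" using subsystem_diff[OF P(1) ab] by simp
  then have d': "- (\<alpha> - \<beta>) \<in> \<Psi>" using P(1) unfolding subsystem_def by blast
  have "\<lfloor>x \<bullet> \<alpha>\<rfloor> = \<lfloor>x \<bullet> \<beta>\<rfloor> + \<lfloor>x \<bullet> (\<alpha> - \<beta>)\<rfloor> \<or> \<lfloor>x \<bullet> \<alpha>\<rfloor> = \<lfloor>x \<bullet> \<beta>\<rfloor> + \<lfloor>x \<bullet> (\<alpha> - \<beta>)\<rfloor> + 1"
    using floor_root_add[of x \<beta> "\<alpha> - \<beta>"] by simp
  then show False
  proof
    assume "\<lfloor>x \<bullet> \<alpha>\<rfloor> = \<lfloor>x \<bullet> \<beta>\<rfloor> + \<lfloor>x \<bullet> (\<alpha> - \<beta>)\<rfloor>"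
    moreover have "\<alpha> = \<beta> + (\<alpha> - \<beta>)" by simp
    ultimately show False using n(1) ab d unfolding decomposable_def by blast
  next
    assume "\<lfloor>x \<bullet> \<alpha>\<rfloor> = \<lfloor>x \<bullet> \<beta>\<rfloor> + \<lfloor>x \<bullet> (\<alpha> - \<beta>)\<rfloor> + 1"
    then have "\<lfloor>x \<bullet> \<beta>\<rfloor> = \<lfloor>x \<bullet> \<alpha>\<rfloor> + \<lfloor>x \<bullet> (- (\<alpha> - \<beta>))\<rfloor>" using floor_root_uminus[OF P(2) d] by simp
    moreover have "\<beta> = \<alpha> + (- (\<alpha> - \<beta>))" by simp
    ultimately show False using n(2) ab d' unfolding decomposable_def by blast
  qed
qed

text \<open>
  \<open>p\<close> is the orthogonal projection of \<open>x\<close>. For an indecomposable \<open>\<gamma> \<notin> S\<close> the step from \<open>x\<close> to \<open>p\<close> only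
  increases the value of \<open>\<gamma>\<close>, by obtuseness; the other roots follow by induction on the fractional part,
  which is additive along decompositions.
\<close>

lemma projection_to_face:
  assumes P: "subsystem \<Psi>" "nonint \<Psi> x" and S: "S \<subseteq> \<Psi>"
    and ind: "\<And>a. a \<in> S \<Longrightarrow> \<not> decomposable \<Psi> x a"
    and u: "\<And>a. a \<in> S \<Longrightarrow> u a \<in> span S" "\<And>a b. a \<in> S \<Longrightarrow> b \<in> S \<Longrightarrow> u a \<bullet> b = (if a = b then 1 else 0)"
    and p: "p = x - (\<Sum>a\<in>S. frac (x \<bullet> a) *\<^sub>R u a)"
  shows "b \<in> S \<Longrightarrow> p \<bullet> b = of_int \<lfloor>x \<bullet> b\<rfloor>"
    and "\<gamma> \<in> \<Psi> \<Longrightarrow> of_int \<lfloor>x \<bullet> \<gamma>\<rfloor> \<le> p \<bullet> \<gamma> \<and> (p \<bullet> \<gamma> = of_int \<lfloor>x \<bullet> \<gamma>\<rfloor> \<longrightarrow>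
      (\<exists>c::'a\<Rightarrow>real. (\<forall>b\<in>S. c b \<ge> 0) \<and> \<gamma> = (\<Sum>b\<in>S. c b *\<^sub>R b) \<and>
        of_int \<lfloor>x \<bullet> \<gamma>\<rfloor> = (\<Sum>b\<in>S. c b * of_int \<lfloor>x \<bullet> b\<rfloor>)))"
proof -
  have fP: "finite \<Psi>" using P(1) finite_roots finite_subset unfolding subsystem_def by blast
  have fS: "finite S" using S fP finite_subset by blast
  define d where "d = (\<Sum>a\<in>S. frac (x \<bullet> a) *\<^sub>R u a)"
  have db: "d \<bullet> b = frac (x \<bullet> b)" if "b \<in> S" for b
  proof -
    have "d \<bullet> b = (\<Sum>a\<in>S. if b = a then frac (x \<bullet> a) else 0)"
      unfolding d_def inner_sum_left by (rule sum.cong) (use u that in auto)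
    then show ?thesis using fS that by simp
  qed
  have pb: "p \<bullet> b = of_int \<lfloor>x \<bullet> b\<rfloor>" if "b \<in> S" for b
    using db[OF that] unfolding p d_def[symmetric] by (simp add: inner_diff_left frac_def)
  then show "b \<in> S \<Longrightarrow> p \<bullet> b = of_int \<lfloor>x \<bullet> b\<rfloor>" .
  \<comment> \<open>The displacement \<open>d\<close> pairs with each member of \<open>S\<close> to
    a fractional part, which is nonnegative, so obtuseness gives it nonnegative coefficients. They
    are what makes \<open>d \<bullet> \<gamma> \<le> 0\<close> for a further indecomposable
    \<open>\<gamma>\<close>.\<close>
  have "d \<in> span S" unfolding d_def by (intro span_sum span_scale u(1))
  then obtain t where "d = (\<Sum>a\<in>S. t a *\<^sub>R a)" using span_finite[OF fS] by auto
  moreover have "obtuse S" unfolding obtuse_def using indecomposable_obtuse[OF P] ind S by blast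
  ultimately obtain s where s: "\<forall>a\<in>S. s a \<ge> 0" "d = (\<Sum>a\<in>S. s a *\<^sub>R a)"
    using obtuse_nonneg_coeffs[OF fS, of d t] db frac_ge_0 by metis
  have fpos: "frac (x \<bullet> \<gamma>) > 0" if "\<gamma> \<in> \<Psi>" for \<gamma>
    using P(2) that unfolding nonint_def by (simp add: frac_gt_0_iff)
  show "\<gamma> \<in> \<Psi> \<Longrightarrow> of_int \<lfloor>x \<bullet> \<gamma>\<rfloor> \<le> p \<bullet> \<gamma> \<and> (p \<bullet> \<gamma> = of_int \<lfloor>x \<bullet> \<gamma>\<rfloor> \<longrightarrow>
      (\<exists>c::'a\<Rightarrow>real. (\<forall>b\<in>S. c b \<ge> 0) \<and> \<gamma> = (\<Sum>b\<in>S. c b *\<^sub>R b) \<and>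
        of_int \<lfloor>x \<bullet> \<gamma>\<rfloor> = (\<Sum>b\<in>S. c b * of_int \<lfloor>x \<bullet> b\<rfloor>)))"
  proof (induction "card {\<delta>\<in>\<Psi>. frac (x \<bullet> \<delta>) < frac (x \<bullet> \<gamma>)}" arbitrary: \<gamma> rule: less_induct)
    case less
    show ?case
    proof (cases "decomposable \<Psi> x \<gamma>")
      case True
      then obtain \<mu> \<nu> where mn: "\<mu> \<in> \<Psi>" "\<nu> \<in> \<Psi>" "\<gamma> = \<mu> + \<nu>" "\<lfloor>x \<bullet> \<gamma>\<rfloor> = \<lfloor>x \<bullet> \<mu>\<rfloor> + \<lfloor>x \<bullet> \<nu>\<rfloor>"
        unfolding decomposable_def by blast
      have "frac (x \<bullet> \<gamma>) = frac (x \<bullet> \<mu>) + frac (x \<bullet> \<nu>)"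
        unfolding frac_def mn(4) unfolding mn(3) by (simp add: inner_add_right)
      then have lt: "frac (x \<bullet> \<mu>) < frac (x \<bullet> \<gamma>)" "frac (x \<bullet> \<nu>) < frac (x \<bullet> \<gamma>)"
        using fpos mn by force+
      have card: "card {\<delta>\<in>\<Psi>. frac (x \<bullet> \<delta>) < frac (x \<bullet> \<mu>)} < card {\<delta>\<in>\<Psi>. frac (x \<bullet> \<delta>) < frac (x \<bullet> \<gamma>)}"
        if "\<mu> \<in> \<Psi>" "frac (x \<bullet> \<mu>) < frac (x \<bullet> \<gamma>)" for \<mu>
        using that fP by (intro psubset_card_mono) auto
      note m = less(1)[OF card[OF mn(1) lt(1)] mn(1)] and n = less(1)[OF card[OF mn(2) lt(2)] mn(2)]
      have pg: "p \<bullet> \<gamma> = p \<bullet> \<mu> + p \<bullet> \<nu>" unfolding mn(3) by (simp add: inner_add_right)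
      have fg: "real_of_int \<lfloor>x \<bullet> \<gamma>\<rfloor> = of_int \<lfloor>x \<bullet> \<mu>\<rfloor> + of_int \<lfloor>x \<bullet> \<nu>\<rfloor>" unfolding mn(4) by simp
      show ?thesis
      proof (intro conjI impI)
        show "of_int \<lfloor>x \<bullet> \<gamma>\<rfloor> \<le> p \<bullet> \<gamma>" using m n pg fg by linarith
        assume "p \<bullet> \<gamma> = of_int \<lfloor>x \<bullet> \<gamma>\<rfloor>"
        \<comment> \<open>Two lower bounds whose sum is attained are both attained.\<close>
        then have e: "p \<bullet> \<mu> = of_int \<lfloor>x \<bullet> \<mu>\<rfloor>" "p \<bullet> \<nu> = of_int \<lfloor>x \<bullet> \<nu>\<rfloor>" using m n pg fg by linarith+
        obtain c :: "'a \<Rightarrow> real" where c: "\<forall>b\<in>S. c b \<ge> 0" "\<mu> = (\<Sum>b\<in>S. c b *\<^sub>R b)"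
          "of_int \<lfloor>x \<bullet> \<mu>\<rfloor> = (\<Sum>b\<in>S. c b * of_int \<lfloor>x \<bullet> b\<rfloor>)" using m e(1) by blast
        obtain c' :: "'a \<Rightarrow> real" where c': "\<forall>b\<in>S. c' b \<ge> 0" "\<nu> = (\<Sum>b\<in>S. c' b *\<^sub>R b)"
          "of_int \<lfloor>x \<bullet> \<nu>\<rfloor> = (\<Sum>b\<in>S. c' b * of_int \<lfloor>x \<bullet> b\<rfloor>)" using n e(2) by blast
        show "\<exists>c::'a\<Rightarrow>real. (\<forall>b\<in>S. c b \<ge> 0) \<and> \<gamma> = (\<Sum>b\<in>S. c b *\<^sub>R b) \<and>
            of_int \<lfloor>x \<bullet> \<gamma>\<rfloor> = (\<Sum>b\<in>S. c b * of_int \<lfloor>x \<bullet> b\<rfloor>)"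
        proof (intro exI[of _ "\<lambda>b. c b + c' b"] conjI)
          show "\<forall>b\<in>S. 0 \<le> c b + c' b" using c(1) c'(1) by simp
          show "\<gamma> = (\<Sum>b\<in>S. (c b + c' b) *\<^sub>R b)" unfolding mn(3) c(2) c'(2) by (simp add: scaleR_add_left sum.distrib)
          show "of_int \<lfloor>x \<bullet> \<gamma>\<rfloor> = (\<Sum>b\<in>S. (c b + c' b) * of_int \<lfloor>x \<bullet> b\<rfloor>)"
            unfolding fg c(3) c'(3) by (simp add: distrib_right sum.distrib)
        qed
      qed
    next
      case False
      show ?thesis
      proof (cases "\<gamma> \<in> S")
        case True
        have "\<gamma> = (\<Sum>b\<in>S. (if b = \<gamma> then 1 else 0) *\<^sub>R b)"
        proof -
          have "(\<Sum>b\<in>S. (if b = \<gamma> then 1 else 0) *\<^sub>R b) = (\<Sum>b\<in>S. if b = \<gamma> then b else 0)"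
            by (rule sum.cong) auto
          then show ?thesis using fS True by simp
        qed
        moreover have "real_of_int \<lfloor>x \<bullet> \<gamma>\<rfloor> = (\<Sum>b\<in>S. (if b = \<gamma> then 1 else 0) * of_int \<lfloor>x \<bullet> b\<rfloor>)"
        proof -
          have "(\<Sum>b\<in>S. (if b = \<gamma> then 1 else 0) * real_of_int \<lfloor>x \<bullet> b\<rfloor>) = (\<Sum>b\<in>S. if b = \<gamma> then real_of_int \<lfloor>x \<bullet> b\<rfloor> else 0)"
            by (rule sum.cong) auto
          then show ?thesis using fS True by simp
        qed
        ultimately show ?thesis using pb[OF True]
          by (intro conjI impI exI[of _ "\<lambda>b. if b = \<gamma> then 1 else 0"]) auto
      next
        case F: False
        have "d \<bullet> \<gamma> \<le> 0" unfolding s(2) inner_sum_left inner_scaleR_left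
        proof (rule sum_nonpos)
          fix a assume a: "a \<in> S"
          then have "a \<bullet> \<gamma> \<le> 0" using indecomposable_obtuse[OF P, of a \<gamma>] ind False F less(2) S by blast
          then show "s a * (a \<bullet> \<gamma>) \<le> 0" using s(1) a by (simp add: mult_nonneg_nonpos)
        qed
        moreover have "p \<bullet> \<gamma> = x \<bullet> \<gamma> - d \<bullet> \<gamma>" unfolding p d_def[symmetric] by (rule inner_diff_left)
        ultimately have "of_int \<lfloor>x \<bullet> \<gamma>\<rfloor> < p \<bullet> \<gamma>" using fpos[OF less(2)] unfolding frac_def by linarith
        then show ?thesis by simp
      qed
    qed
  qed
qed

text \<open>
  Of the two kinds of decomposition, \<open>\<alpha> = \<beta> + \<gamma>\<close> inside \<open>Q\<close> and \<open>\<alpha> = (\<alpha> + \<gamma>) + (- \<gamma>)\<close>, the second one can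
  be traded away as long as \<open>\<alpha> + \<gamma>\<close> lies in \<open>Hi\<close>: take \<open>\<gamma>\<close> minimal, split \<open>\<alpha> + \<gamma> = \<mu> + \<nu>\<close> inside \<open>Q\<close> by
  induction, and note that some inner product of \<open>\<alpha>, \<gamma>\<close> with \<open>\<mu>, \<nu>\<close> is positive, so their difference is
  a root that allows regrouping the four summands. \<open>Hi\<close> will be the set of roots whose level
  \<open>\<lfloor>x \<bullet> \<beta>\<rfloor>\<close> lies outside the range of the arrangement.
\<close>

lemma regroup:
  assumes P: "subsystem \<Psi>" "nonint \<Psi> x" and Q: "Q = {\<alpha>\<in>\<Psi>. \<alpha> \<bullet> w > 0}" "w = v \<or> w = - v"
    and Hi: "Hi \<subseteq> Q" "\<And>\<alpha> \<gamma>. \<alpha> \<in> Hi \<Longrightarrow> \<gamma> \<in> Q \<Longrightarrow> \<alpha> + \<gamma> \<in> Q \<Longrightarrow> \<alpha> + \<gamma> \<in> Hi"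
      "\<And>\<alpha>. \<alpha> \<in> Hi \<Longrightarrow> decomposable \<Psi> x \<alpha>"
    and \<alpha>: "\<alpha> \<in> Q" "decomposable \<Psi> x \<alpha>"
  shows "(\<exists>\<beta>\<in>Q. \<exists>\<gamma>\<in>Q. \<alpha> = \<beta> + \<gamma> \<and> \<lfloor>x \<bullet> \<alpha>\<rfloor> = \<lfloor>x \<bullet> \<beta>\<rfloor> + \<lfloor>x \<bullet> \<gamma>\<rfloor>) \<or>
    (\<exists>\<gamma>\<in>Q. \<alpha> + \<gamma> \<in> Q \<and> \<alpha> + \<gamma> \<notin> Hi \<and> \<lfloor>x \<bullet> (\<alpha> + \<gamma>)\<rfloor> = \<lfloor>x \<bullet> \<alpha>\<rfloor> + \<lfloor>x \<bullet> \<gamma>\<rfloor> + 1)"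
  using \<alpha>
proof (induction "card {\<beta>\<in>Q. \<beta> \<bullet> w > \<alpha> \<bullet> w}" arbitrary: \<alpha> rule: less_induct)
  case less
  have fQ: "finite Q" using P(1) finite_roots finite_subset unfolding subsystem_def Q by fastforce
  have QP: "\<beta> \<in> \<Psi>" "\<beta> \<bullet> w > 0" if "\<beta> \<in> Q" for \<beta> using that Q by auto
  have Qn: "\<beta> \<in> Q \<or> - \<beta> \<in> Q" if "\<beta> \<in> \<Psi>" for \<beta>
    using that P(1) Q regular[of \<beta>] unfolding subsystem_def by (auto simp: not_less order_less_le)
  define good where "good = (\<lambda>\<alpha>. \<exists>\<beta>\<in>Q. \<exists>\<gamma>\<in>Q. \<alpha> = \<beta> + \<gamma> \<and> \<lfloor>x \<bullet> \<alpha>\<rfloor> = \<lfloor>x \<bullet> \<beta>\<rfloor> + \<lfloor>x \<bullet> \<gamma>\<rfloor>)"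
  define bad where "bad = (\<lambda>\<alpha> \<gamma>. \<gamma> \<in> Q \<and> \<alpha> + \<gamma> \<in> Q \<and> \<lfloor>x \<bullet> (\<alpha> + \<gamma>)\<rfloor> = \<lfloor>x \<bullet> \<alpha>\<rfloor> + \<lfloor>x \<bullet> \<gamma>\<rfloor> + 1)"
  have "good \<alpha> \<or> (\<exists>\<gamma>. bad \<alpha> \<gamma> \<and> \<alpha> + \<gamma> \<notin> Hi)"
  proof (rule ccontr)
    assume "\<not> ?thesis"
    then have ng: "\<not> good \<alpha>" and nb: "\<And>\<gamma>. bad \<alpha> \<gamma> \<Longrightarrow> \<alpha> + \<gamma> \<in> Hi" by blast+
    have badI: "\<exists>\<gamma>. bad \<alpha> \<gamma>" if m: "\<mu> \<in> Q" "\<nu> \<in> \<Psi>" "\<alpha> = \<mu> + \<nu>" "\<lfloor>x \<bullet> \<alpha>\<rfloor> = \<lfloor>x \<bullet> \<mu>\<rfloor> + \<lfloor>x \<bullet> \<nu>\<rfloor>" for \<mu> \<nu>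
    proof -
      have "\<nu> \<notin> Q" using ng m unfolding good_def by blast
      then have n: "- \<nu> \<in> Q" using Qn m by blast
      \<comment> \<open>Read as \<open>\<alpha> + (- \<nu>) = \<mu>\<close>, the exact sum of levels
        acquires a carry 1 through negation.\<close>
      have "bad \<alpha> (- \<nu>)" unfolding bad_def using n m floor_root_uminus[OF P(2) m(2)] by simp
      then show ?thesis by blast
    qed
    obtain \<mu> \<nu> where mn: "\<mu> \<in> \<Psi>" "\<nu> \<in> \<Psi>" "\<alpha> = \<mu> + \<nu>" "\<lfloor>x \<bullet> \<alpha>\<rfloor> = \<lfloor>x \<bullet> \<mu>\<rfloor> + \<lfloor>x \<bullet> \<nu>\<rfloor>"
      using less(3) unfolding decomposable_def by blast
    have "\<mu> \<bullet> w + \<nu> \<bullet> w > 0" using QP(2)[OF less(2)] mn(3) by (simp add: inner_add_left)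
    then have "\<mu> \<bullet> w > 0 \<or> \<nu> \<bullet> w > 0" by linarith
    then have "\<mu> \<in> Q \<or> \<nu> \<in> Q" using mn Q by blast
    then have "\<exists>\<gamma>. bad \<alpha> \<gamma>" using badI[of \<mu> \<nu>] badI[of \<nu> \<mu>] mn by (auto simp: add.commute)
    moreover have "finite {\<gamma>. bad \<alpha> \<gamma>}" using fQ unfolding bad_def by (rule rev_finite_subset) auto
    ultimately have "\<exists>\<gamma>. bad \<alpha> \<gamma> \<and> (\<forall>\<delta>. bad \<alpha> \<delta> \<longrightarrow> \<gamma> \<bullet> w \<le> \<delta> \<bullet> w)"
      using ex_min_if_finite[of "(\<lambda>\<gamma>. \<gamma> \<bullet> w) ` {\<gamma>. bad \<alpha> \<gamma>}"] by (auto simp: not_less)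
    then obtain \<gamma> where \<gamma>: "bad \<alpha> \<gamma>" and min: "\<And>\<delta>. bad \<alpha> \<delta> \<Longrightarrow> \<gamma> \<bullet> w \<le> \<delta> \<bullet> w" by blast
    have ag: "\<alpha> + \<gamma> \<in> Hi" "\<alpha> + \<gamma> \<in> Q" "\<gamma> \<in> Q" using nb[OF \<gamma>] Hi(1) \<gamma> unfolding bad_def by auto
    have "card {\<beta>\<in>Q. \<beta> \<bullet> w > (\<alpha> + \<gamma>) \<bullet> w} < card {\<beta>\<in>Q. \<beta> \<bullet> w > \<alpha> \<bullet> w}"
    proof (rule psubset_card_mono)
      have "\<alpha> \<bullet> w < (\<alpha> + \<gamma>) \<bullet> w" using QP(2)[OF ag(3)] by (simp add: inner_add_left)
      then show "{\<beta>\<in>Q. \<beta> \<bullet> w > (\<alpha> + \<gamma>) \<bullet> w} \<subset> {\<beta>\<in>Q. \<beta> \<bullet> w > \<alpha> \<bullet> w}" using ag(2) by force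
    qed (use fQ in simp)
    \<comment> \<open>The second alternative for \<open>\<alpha> + \<gamma>\<close> would leave
      \<open>Hi\<close> by adding a root of \<open>Q\<close>, against its upward closure.\<close>
    from less(1)[OF this ag(2) Hi(3)[OF ag(1)]]
    obtain \<mu> \<nu> where mn: "\<mu> \<in> Q" "\<nu> \<in> Q" "\<alpha> + \<gamma> = \<mu> + \<nu>" "\<lfloor>x \<bullet> (\<alpha> + \<gamma>)\<rfloor> = \<lfloor>x \<bullet> \<mu>\<rfloor> + \<lfloor>x \<bullet> \<nu>\<rfloor>"
      using Hi(2)[OF ag(1)] by blast
    have eq: "\<lfloor>x \<bullet> \<mu>\<rfloor> + \<lfloor>x \<bullet> \<nu>\<rfloor> = \<lfloor>x \<bullet> \<alpha>\<rfloor> + \<lfloor>x \<bullet> \<gamma>\<rfloor> + 1" using \<gamma> mn(4) unfolding bad_def by simp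
    have key: False if mn: "\<mu> \<in> Q" "\<nu> \<in> Q" "\<alpha> + \<gamma> = \<mu> + \<nu>"
        and eq: "\<lfloor>x \<bullet> \<mu>\<rfloor> + \<lfloor>x \<bullet> \<nu>\<rfloor> = \<lfloor>x \<bullet> \<alpha>\<rfloor> + \<lfloor>x \<bullet> \<gamma>\<rfloor> + 1"
        and pos: "\<alpha> \<bullet> \<mu> > 0 \<or> \<gamma> \<bullet> \<mu> > 0" for \<mu> \<nu>
      using pos
    proof
      assume am: "\<alpha> \<bullet> \<mu> > 0"
      have ne: "\<alpha> \<noteq> \<mu>" using mn(3) eq by auto
      have d: "\<alpha> - \<mu> \<in> \<Psi>" using subsystem_diff[OF P(1) _ _ ne am] QP less(2) mn by blast
      have a: "\<alpha> = \<mu> + (\<alpha> - \<mu>)" and n: "\<nu> = \<gamma> + (\<alpha> - \<mu>)" using mn(3) by (simp_all add: algebra_simps)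
      have fa: "\<lfloor>x \<bullet> \<alpha>\<rfloor> = \<lfloor>x \<bullet> \<mu>\<rfloor> + \<lfloor>x \<bullet> (\<alpha> - \<mu>)\<rfloor> \<or> \<lfloor>x \<bullet> \<alpha>\<rfloor> = \<lfloor>x \<bullet> \<mu>\<rfloor> + \<lfloor>x \<bullet> (\<alpha> - \<mu>)\<rfloor> + 1"
        using floor_root_add[of x \<mu> "\<alpha> - \<mu>"] a by simp
      have fn: "\<lfloor>x \<bullet> \<nu>\<rfloor> = \<lfloor>x \<bullet> \<gamma>\<rfloor> + \<lfloor>x \<bullet> (\<alpha> - \<mu>)\<rfloor> \<or> \<lfloor>x \<bullet> \<nu>\<rfloor> = \<lfloor>x \<bullet> \<gamma>\<rfloor> + \<lfloor>x \<bullet> (\<alpha> - \<mu>)\<rfloor> + 1"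
        using floor_root_add[of x \<gamma> "\<alpha> - \<mu>"] n by simp
      \<comment> \<open>By \<open>eq\<close> the carry in \<open>fn\<close> exceeds the carry in
        \<open>fa\<close> by 1, so they are 1 and 0. The other case below uses the same
        count.\<close>
      have fe: "\<lfloor>x \<bullet> \<alpha>\<rfloor> = \<lfloor>x \<bullet> \<mu>\<rfloor> + \<lfloor>x \<bullet> (\<alpha> - \<mu>)\<rfloor>" using fa fn eq by linarith
      show False
      proof (cases "\<alpha> - \<mu> \<in> Q")
        case True
        then show False using ng mn a fe unfolding good_def by blast
      next
        case False
        then have e: "- (\<alpha> - \<mu>) \<in> Q" using Qn d by blast
        have "bad \<alpha> (- (\<alpha> - \<mu>))" unfolding bad_def using e mn fe floor_root_uminus[OF P(2) d] by simp
        from min[OF this] have "\<gamma> \<bullet> w \<le> - (\<alpha> - \<mu>) \<bullet> w" .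
        moreover have "\<gamma> \<bullet> w = \<nu> \<bullet> w + - (\<alpha> - \<mu>) \<bullet> w" using n by (simp add: inner_add_left inner_diff_left)
        ultimately show False using QP(2)[OF mn(2)] by linarith
      qed
    next
      assume gm: "\<gamma> \<bullet> \<mu> > 0"
      have ne: "\<gamma> \<noteq> \<mu>" using mn(3) eq by auto
      have d: "\<gamma> - \<mu> \<in> \<Psi>" using subsystem_diff[OF P(1) _ _ ne gm] QP ag(3) mn by blast
      have g: "\<gamma> = \<mu> + (\<gamma> - \<mu>)" and n: "\<nu> = \<alpha> + (\<gamma> - \<mu>)" using mn(3) by (simp_all add: algebra_simps)
      have fg: "\<lfloor>x \<bullet> \<gamma>\<rfloor> = \<lfloor>x \<bullet> \<mu>\<rfloor> + \<lfloor>x \<bullet> (\<gamma> - \<mu>)\<rfloor> \<or> \<lfloor>x \<bullet> \<gamma>\<rfloor> = \<lfloor>x \<bullet> \<mu>\<rfloor> + \<lfloor>x \<bullet> (\<gamma> - \<mu>)\<rfloor> + 1"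
        using floor_root_add[of x \<mu> "\<gamma> - \<mu>"] g by simp
      have fn: "\<lfloor>x \<bullet> \<nu>\<rfloor> = \<lfloor>x \<bullet> \<alpha>\<rfloor> + \<lfloor>x \<bullet> (\<gamma> - \<mu>)\<rfloor> \<or> \<lfloor>x \<bullet> \<nu>\<rfloor> = \<lfloor>x \<bullet> \<alpha>\<rfloor> + \<lfloor>x \<bullet> (\<gamma> - \<mu>)\<rfloor> + 1"
        using floor_root_add[of x \<alpha> "\<gamma> - \<mu>"] n by simp
      have fe: "\<lfloor>x \<bullet> \<nu>\<rfloor> = \<lfloor>x \<bullet> \<alpha>\<rfloor> + \<lfloor>x \<bullet> (\<gamma> - \<mu>)\<rfloor> + 1" using fg fn eq by linarith
      show False
      proof (cases "\<gamma> - \<mu> \<in> Q")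
        case True
        have "bad \<alpha> (\<gamma> - \<mu>)" unfolding bad_def using True mn(2) fe n[symmetric] by simp
        from min[OF this] show False using QP(2)[OF mn(1)] by (simp add: inner_diff_left)
      next
        case False
        then have e: "- (\<gamma> - \<mu>) \<in> Q" using Qn d by blast
        have "\<alpha> = \<nu> + - (\<gamma> - \<mu>)" using n by simp
        moreover have "\<lfloor>x \<bullet> \<alpha>\<rfloor> = \<lfloor>x \<bullet> \<nu>\<rfloor> + \<lfloor>x \<bullet> (- (\<gamma> - \<mu>))\<rfloor>" using fe floor_root_uminus[OF P(2) d] by simp
        ultimately show False using ng mn(2) e unfolding good_def by blast
      qed
    qed
    have "\<alpha> + \<gamma> \<noteq> 0" using QP(2)[OF ag(2)] by auto
    \<comment> \<open>The product is the squared length of \<open>\<alpha> + \<gamma>\<close>, so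
      one of its four terms is positive.\<close>
    then have "(\<alpha> + \<gamma>) \<bullet> (\<mu> + \<nu>) > 0" unfolding mn(3)[symmetric] by simp
    then have "(\<alpha> \<bullet> \<mu> > 0 \<or> \<gamma> \<bullet> \<mu> > 0) \<or> (\<alpha> \<bullet> \<nu> > 0 \<or> \<gamma> \<bullet> \<nu> > 0)"
      by (simp add: inner_add_left inner_add_right) linarith
    then show False using key[OF mn(1-3) eq] key[of \<nu> \<mu>] mn eq by (auto simp: add.commute)
  qed
  then show ?case unfolding good_def bad_def by blast
qed

end

section \<open>Points far out in unbounded directions\<close>

text \<open>The points to avoid lie in countably many hyperplanes, a null set.\<close>

lemma exists_nonint_point:
  fixes R \<Psi> :: "'a::euclidean_space set"
  assumes "open R" "R \<noteq> {}" "finite \<Psi>" "0 \<notin> \<Psi>"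
  shows "\<exists>x\<in>R. \<forall>\<alpha>\<in>\<Psi>. x \<bullet> \<alpha> \<notin> \<int>"
proof (rule ccontr)
  assume "\<not> ?thesis"
  then have "R \<subseteq> (\<Union>\<alpha>\<in>\<Psi>. \<Union>i\<in>\<int>. {x. \<alpha> \<bullet> x = i})" by (force simp: inner_commute)
  moreover have "negligible (\<Union>\<alpha>\<in>\<Psi>. \<Union>i\<in>\<int>. {x. \<alpha> \<bullet> x = i})"
  proof (rule negligible_countable_Union)
    show "countable ((\<lambda>\<alpha>. \<Union>i\<in>\<int>. {x. \<alpha> \<bullet> x = i}) ` \<Psi>)" using assms(3) by (simp add: countable_finite)
    fix A assume "A \<in> (\<lambda>\<alpha>. \<Union>i\<in>\<int>. {x. \<alpha> \<bullet> x = i}) ` \<Psi>"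
    then obtain \<alpha> where \<alpha>: "\<alpha> \<in> \<Psi>" "A = (\<Union>i\<in>\<int>. {x. \<alpha> \<bullet> x = i})" by blast
    have "countable (\<int> :: real set)" unfolding Ints_def by simp
    then show "negligible A" unfolding \<alpha>(2) using \<alpha>(1) assms(4)
      by (intro negligible_countable_Union) (auto intro: negligible_hyperplane)
  qed
  ultimately show False using open_not_negligible[OF assms(1,2)] negligible_subset by blast
qed

context root_arrangement
begin

text \<open>
  Replacing \<open>x\<close> by a far point of the same \<open>\<Psi>\<close>-alcove makes the hyperplanes of roots outside \<open>\<Psi>\<close> irrelevant.
\<close>

definition far_points :: "'a set \<Rightarrow> 'a set \<Rightarrow> bool" where
  "far_points \<Psi> R \<longleftrightarrow> (\<forall>x\<in>R. nonint \<Psi> x \<longrightarrow> (\<forall>C. \<exists>x'\<in>R. nonint \<Psi> x' \<and>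
     (\<forall>\<beta>\<in>\<Psi>. \<lfloor>x' \<bullet> \<beta>\<rfloor> = \<lfloor>x \<bullet> \<beta>\<rfloor>) \<and> (\<forall>\<beta>\<in>pos - \<Psi>. C < x' \<bullet> \<beta>)))"

lemma far_points_all: "far_points \<Phi> R"
  unfolding far_points_def pos_def by auto

text \<open>All roots of \<open>T\<close> are positive on \<open>R\<close>, so passing to a midpoint
  at most halves a large value; this is why \<open>2 * C\<close> is requested at the two
  ends.\<close>

lemma far_pair:
  assumes R: "R \<in> regions (catalan_arr \<Phi> k)" "convex R" "dominant pos R"
    and T: "finite T" "T \<subseteq> pos" "\<And>\<beta> C. \<beta> \<in> T \<Longrightarrow> \<exists>y\<in>R. C < y \<bullet> \<beta>"
  shows "\<exists>y\<in>R. \<forall>\<beta>\<in>T. C < y \<bullet> \<beta>"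
  using T
proof (induction T arbitrary: C rule: finite_induct)
  case empty
  then show ?case using region_nonempty[OF R(1)] by auto
next
  case (insert \<beta> T)
  obtain y where y: "y \<in> R" "\<forall>\<beta>\<in>T. 2 * C < y \<bullet> \<beta>" using insert.IH[of "2 * C"] insert.prems by blast
  obtain z where z: "z \<in> R" "2 * C < z \<bullet> \<beta>" using insert.prems by blast
  define m where "m = (1/2) *\<^sub>R y + (1/2) *\<^sub>R z"
  have "m \<in> R" unfolding m_def using convexD[OF R(2) y(1) z(1), of "1/2" "1/2"] by simp
  moreover have p: "y \<bullet> \<gamma> > 0" "z \<bullet> \<gamma> > 0" if "\<gamma> \<in> insert \<beta> T" for \<gamma>
    using R(3) y(1) z(1) insert.prems(1) that unfolding dominant_def by blast+
  have "C < m \<bullet> \<gamma>" if g: "\<gamma> \<in> insert \<beta> T" for \<gamma>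
  proof -
    have "m \<bullet> \<gamma> = (y \<bullet> \<gamma> + z \<bullet> \<gamma>) / 2" unfolding m_def by (simp add: inner_add_left)
    moreover have "2 * C < y \<bullet> \<gamma> \<or> 2 * C < z \<bullet> \<gamma>" using g y(2) z(2) by blast
    ultimately show ?thesis using p[OF g] by argo
  qed
  ultimately show ?case by blast
qed

section \<open>Roots that survive in the treatment of ceilings\<close>

definition bounded_roots :: "'a set \<Rightarrow> 'a set" where
  "bounded_roots R = {\<beta>\<in>\<Phi>. \<exists>C. \<forall>y\<in>R. \<bar>y \<bullet> \<beta>\<bar> \<le> C}"

lemma subsystem_all: "subsystem \<Phi>"
  unfolding subsystem_def using root_uminus[OF crys] by blast

lemma subsystem_bounded_roots: "subsystem (bounded_roots R)"
  unfolding subsystem_def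
proof (intro conjI ballI impI)
  show "bounded_roots R \<subseteq> \<Phi>" unfolding bounded_roots_def by blast
  fix \<alpha> assume a: "\<alpha> \<in> bounded_roots R"
  then show "- \<alpha> \<in> bounded_roots R" using root_uminus[OF crys] unfolding bounded_roots_def by auto
  fix \<beta> assume b: "\<beta> \<in> bounded_roots R" "\<alpha> + \<beta> \<in> \<Phi>"
  obtain C D where "\<forall>y\<in>R. \<bar>y \<bullet> \<alpha>\<bar> \<le> C" "\<forall>y\<in>R. \<bar>y \<bullet> \<beta>\<bar> \<le> D" using a b unfolding bounded_roots_def by blast
  then have "\<forall>y\<in>R. \<bar>y \<bullet> (\<alpha> + \<beta>)\<bar> \<le> C + D" unfolding inner_add_right by (meson abs_triangle_ineq add_mono order_trans)
  then show "\<alpha> + \<beta> \<in> bounded_roots R" using b(2) unfolding bounded_roots_def by blast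
qed

text \<open>Move from \<open>x\<close> by a fraction \<open>e\<close> of the way to a remote point
  \<open>y\<close> of \<open>R\<close>. A bounded root changes by at most
  \<open>e * (2 * B \<beta>)\<close>, less than its distance to both neighbouring integers, whereas
  the remaining positive roots exceed \<open>C\<close>.\<close>

lemma far_points_bounded_roots:
  assumes R: "R \<in> regions (catalan_arr \<Phi> k)" "dominant pos R"
  shows "far_points (bounded_roots R) R"
  unfolding far_points_def
proof (intro ballI impI allI)
  fix x C assume x: "x \<in> R" "nonint (bounded_roots R) x"
  define \<Psi> where "\<Psi> = bounded_roots R"
  have fP: "finite \<Psi>" unfolding \<Psi>_def bounded_roots_def using finite_roots by simp
  have cR: "convex R" using region_convex[OF R(1)] .
  have "\<exists>B. \<forall>y\<in>R. \<bar>y \<bullet> \<beta>\<bar> \<le> B" if "\<beta> \<in> \<Psi>" for \<beta> using that unfolding \<Psi>_def bounded_roots_def by blast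
  then obtain B where B: "\<And>\<beta> y. \<beta> \<in> \<Psi> \<Longrightarrow> y \<in> R \<Longrightarrow> \<bar>y \<bullet> \<beta>\<bar> \<le> B \<beta>" by metis
  have ev: "\<forall>\<^sub>F e in at_right (0::real). e * (2 * B \<beta>) < frac (x \<bullet> \<beta>) \<and> e * (2 * B \<beta>) < 1 - frac (x \<bullet> \<beta>)"
    if "\<beta> \<in> \<Psi>" for \<beta>
  proof -
    have f: "frac (x \<bullet> \<beta>) > 0" "1 - frac (x \<bullet> \<beta>) > 0"
      using x(2) that frac_lt_1[of "x \<bullet> \<beta>"] unfolding nonint_def \<Psi>_def by (simp_all add: frac_gt_0_iff)
    have "((\<lambda>e. e * (2 * B \<beta>)) \<longlongrightarrow> 0 * (2 * B \<beta>)) (at_right (0::real))" by (intro tendsto_intros)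
    then have T: "((\<lambda>e. e * (2 * B \<beta>)) \<longlongrightarrow> 0) (at_right (0::real))" by simp
    show ?thesis by (rule eventually_conj[OF order_tendstoD(2)[OF T f(1)] order_tendstoD(2)[OF T f(2)]])
  qed
  have "\<forall>\<^sub>F e in at_right (0::real). \<forall>\<beta>\<in>\<Psi>. e * (2 * B \<beta>) < frac (x \<bullet> \<beta>) \<and> e * (2 * B \<beta>) < 1 - frac (x \<bullet> \<beta>)"
    by (intro eventually_ball_finite[OF fP] ballI ev)
  moreover have "\<forall>\<^sub>F e in at_right (0::real). e \<in> {0<..<1}" by (rule eventually_at_right_real) simp
  ultimately have "\<forall>\<^sub>F e in at_right (0::real). 0 < e \<and> e < 1 \<and>
      (\<forall>\<beta>\<in>\<Psi>. e * (2 * B \<beta>) < frac (x \<bullet> \<beta>) \<and> e * (2 * B \<beta>) < 1 - frac (x \<bullet> \<beta>))"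
    by eventually_elim auto
  then obtain e :: real where e: "0 < e" "e < 1"
      "\<And>\<beta>. \<beta> \<in> \<Psi> \<Longrightarrow> e * (2 * B \<beta>) < frac (x \<bullet> \<beta>)" "\<And>\<beta>. \<beta> \<in> \<Psi> \<Longrightarrow> e * (2 * B \<beta>) < 1 - frac (x \<bullet> \<beta>)"
    using eventually_happens'[OF trivial_limit_at_right_real] by blast
  have unb: "\<exists>y\<in>R. D < y \<bullet> \<beta>" if b: "\<beta> \<in> pos - \<Psi>" for \<beta> D
  proof (rule ccontr)
    assume n: "\<not> ?thesis"
    have "\<bar>y \<bullet> \<beta>\<bar> \<le> D" if "y \<in> R" for y
    proof -
      have "y \<bullet> \<beta> > 0" using R(2) b that unfolding dominant_def by blast
      moreover have "y \<bullet> \<beta> \<le> D" using n that by force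
      ultimately show ?thesis by simp
    qed
    then show False using b unfolding \<Psi>_def bounded_roots_def pos_def by blast
  qed
  have "finite (pos - \<Psi>)" using finite_roots unfolding pos_def by simp
  \<comment> \<open>The fraction \<open>e\<close> depends only on \<open>x\<close> and the bounds
    \<open>B\<close>, so \<open>y\<close> may be chosen afterwards; its values are later multiplied
    by \<open>e\<close>, whence \<open>C / e\<close>.\<close>
  then obtain y where y: "y \<in> R" "\<forall>\<beta>\<in>pos - \<Psi>. C / e < y \<bullet> \<beta>"
    using far_pair[OF R(1) cR R(2), of "pos - \<Psi>" "C / e"] unb by blast
  define x' where "x' = (1 - e) *\<^sub>R x + e *\<^sub>R y"
  have "x' \<in> R" unfolding x'_def using convexD[OF cR x(1) y(1), of "1 - e" e] e(1,2) by simp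
  moreover have "C < x' \<bullet> \<beta>" if b: "\<beta> \<in> pos - \<Psi>" for \<beta>
  proof -
    have "x \<bullet> \<beta> > 0" using R(2) b x(1) unfolding dominant_def by blast
    then have "(1 - e) * (x \<bullet> \<beta>) > 0" using e(2) by simp
    moreover have "C < e * (y \<bullet> \<beta>)" using y(2) b e(1) by (simp add: pos_divide_less_eq mult.commute)
    ultimately show ?thesis unfolding x'_def by (simp add: inner_add_left)
  qed
  moreover have fl: "\<lfloor>x' \<bullet> \<beta>\<rfloor> = \<lfloor>x \<bullet> \<beta>\<rfloor> \<and> x' \<bullet> \<beta> \<notin> \<int>" if b: "\<beta> \<in> \<Psi>" for \<beta>
  proof -
    have "x' \<bullet> \<beta> = x \<bullet> \<beta> + e * (y \<bullet> \<beta> - x \<bullet> \<beta>)" unfolding x'_def by (simp add: inner_add_left algebra_simps)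
    moreover have "\<bar>y \<bullet> \<beta> - x \<bullet> \<beta>\<bar> \<le> 2 * B \<beta>" using B[OF b x(1)] B[OF b y(1)] by linarith
    then have "\<bar>e * (y \<bullet> \<beta> - x \<bullet> \<beta>)\<bar> \<le> e * (2 * B \<beta>)" using e(1) by (simp add: abs_mult)
    ultimately have lu: "of_int \<lfloor>x \<bullet> \<beta>\<rfloor> < x' \<bullet> \<beta>" "x' \<bullet> \<beta> < of_int \<lfloor>x \<bullet> \<beta>\<rfloor> + 1"
      using e(3,4)[OF b] unfolding frac_def by linarith+
    then have fl: "\<lfloor>x' \<bullet> \<beta>\<rfloor> = \<lfloor>x \<bullet> \<beta>\<rfloor>" by linarith
    moreover have "x' \<bullet> \<beta> \<notin> \<int>" using lu(1) fl by (metis Ints_cases floor_of_int less_irrefl)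
    ultimately show ?thesis by blast
  qed
  ultimately show "\<exists>x'\<in>R. nonint (bounded_roots R) x' \<and> (\<forall>\<beta>\<in>bounded_roots R. \<lfloor>x' \<bullet> \<beta>\<rfloor> = \<lfloor>x \<bullet> \<beta>\<rfloor>) \<and>
      (\<forall>\<beta>\<in>pos - bounded_roots R. C < x' \<bullet> \<beta>)"
    unfolding nonint_def \<Psi>_def[symmetric] by blast
qed

text \<open>The step length is measured in units of \<open>\<alpha> / (\<alpha> \<bullet> \<alpha>)\<close>, so that the bound 2 does not depend on \<open>x\<close>.\<close>

lemma cross_indecomposable:
  assumes P: "subsystem \<Psi>" "nonint \<Psi> x" and a: "\<alpha> \<in> \<Psi>" "\<not> decomposable \<Psi> x \<alpha>"
  shows "\<exists>t. 0 \<le> t \<and> t \<le> 2 \<and> nonint \<Psi> (x - (t / (\<alpha> \<bullet> \<alpha>)) *\<^sub>R \<alpha>) \<and>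
    \<lfloor>(x - (t / (\<alpha> \<bullet> \<alpha>)) *\<^sub>R \<alpha>) \<bullet> \<alpha>\<rfloor> = \<lfloor>x \<bullet> \<alpha>\<rfloor> - 1 \<and>
    (\<forall>\<beta>\<in>\<Psi>. \<beta> \<noteq> \<alpha> \<longrightarrow> \<beta> \<noteq> - \<alpha> \<longrightarrow> \<lfloor>(x - (t / (\<alpha> \<bullet> \<alpha>)) *\<^sub>R \<alpha>) \<bullet> \<beta>\<rfloor> = \<lfloor>x \<bullet> \<beta>\<rfloor>)"
proof -
  have aF: "\<alpha> \<in> \<Phi>" using a P unfolding subsystem_def by blast
  have fP: "finite \<Psi>" using P(1) finite_roots finite_subset unfolding subsystem_def by blast
  have a0: "\<alpha> \<bullet> \<alpha> \<noteq> 0" using root_nonzero[OF aF] by simp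
  define u where "u = (\<lambda>_::'a. (1 / (\<alpha> \<bullet> \<alpha>)) *\<^sub>R \<alpha>)"
  define p where "p = x - (\<Sum>a\<in>{\<alpha>}. frac (x \<bullet> a) *\<^sub>R u a)"
  have u1: "u a \<in> span {\<alpha>}" for a unfolding u_def by (simp add: span_base span_scale)
  have u2: "u a \<bullet> b = (if a = b then 1 else 0)" if "a \<in> {\<alpha>}" "b \<in> {\<alpha>}" for a b using that a0 unfolding u_def by simp
  have pa: "p \<bullet> \<alpha> = of_int \<lfloor>x \<bullet> \<alpha>\<rfloor>"
    by (rule projection_to_face(1)[OF P, of "{\<alpha>}" u]) (use a u1 u2 p_def in auto)
  have proj: "of_int \<lfloor>x \<bullet> \<gamma>\<rfloor> \<le> p \<bullet> \<gamma> \<and> (p \<bullet> \<gamma> = of_int \<lfloor>x \<bullet> \<gamma>\<rfloor> \<longrightarrow>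
      (\<exists>c::'a\<Rightarrow>real. (\<forall>b\<in>{\<alpha>}. c b \<ge> 0) \<and> \<gamma> = (\<Sum>b\<in>{\<alpha>}. c b *\<^sub>R b) \<and>
        of_int \<lfloor>x \<bullet> \<gamma>\<rfloor> = (\<Sum>b\<in>{\<alpha>}. c b * of_int \<lfloor>x \<bullet> b\<rfloor>)))" if "\<gamma> \<in> \<Psi>" for \<gamma>
    by (rule projection_to_face(2)[OF P, of "{\<alpha>}" u]) (use a u1 u2 p_def that in auto)
  \<comment> \<open>Equality would make \<open>\<gamma>\<close> a nonnegative multiple of
    \<open>\<alpha>\<close>, hence \<open>\<alpha>\<close> itself: the foot \<open>p\<close> lies on
    no other wall of the alcove.\<close>
  have pg: "of_int \<lfloor>x \<bullet> \<gamma>\<rfloor> < p \<bullet> \<gamma>" if g: "\<gamma> \<in> \<Psi>" "\<gamma> \<noteq> \<alpha>" for \<gamma>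
  proof (rule ccontr)
    assume "\<not> ?thesis"
    moreover have "of_int \<lfloor>x \<bullet> \<gamma>\<rfloor> \<le> p \<bullet> \<gamma>" using proj[OF g(1)] by blast
    ultimately have "p \<bullet> \<gamma> = of_int \<lfloor>x \<bullet> \<gamma>\<rfloor>" by simp
    then obtain c :: "'a \<Rightarrow> real" where "c \<alpha> \<ge> 0" "\<gamma> = c \<alpha> *\<^sub>R \<alpha>" using proj[OF g(1)] by auto
    moreover have "\<gamma> \<in> \<Phi>" using g P(1) unfolding subsystem_def by blast
    ultimately show False using root_scale[OF aF, of "c \<alpha>"] g(2) by auto
  qed
  have "\<forall>\<^sub>F e in at_right (0::real). \<forall>\<gamma>\<in>\<Psi> - {\<alpha>}. p + e *\<^sub>R (- ((1 / (\<alpha> \<bullet> \<alpha>)) *\<^sub>R \<alpha>)) \<in> {y. \<gamma> \<bullet> y > of_int \<lfloor>x \<bullet> \<gamma>\<rfloor>}"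
    using fP pg by (intro eventually_ball_finite ballI eventually_step_in_open open_halfspace_gt) (auto simp: inner_commute)
  moreover have "\<forall>\<^sub>F e in at_right (0::real). e \<in> {0<..<1}" by (rule eventually_at_right_real) simp
  ultimately have "\<forall>\<^sub>F e in at_right (0::real). 0 < e \<and> e < 1 \<and>
      (\<forall>\<gamma>\<in>\<Psi> - {\<alpha>}. p + e *\<^sub>R (- ((1 / (\<alpha> \<bullet> \<alpha>)) *\<^sub>R \<alpha>)) \<in> {y. \<gamma> \<bullet> y > of_int \<lfloor>x \<bullet> \<gamma>\<rfloor>})"
    by eventually_elim auto
  then obtain e :: real where e: "0 < e" "e < 1"
      "\<And>\<gamma>. \<gamma> \<in> \<Psi> \<Longrightarrow> \<gamma> \<noteq> \<alpha> \<Longrightarrow> p + e *\<^sub>R (- ((1 / (\<alpha> \<bullet> \<alpha>)) *\<^sub>R \<alpha>)) \<in> {y. \<gamma> \<bullet> y > of_int \<lfloor>x \<bullet> \<gamma>\<rfloor>}"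
    using eventually_happens'[OF trivial_limit_at_right_real] by blast
  \<comment> \<open>The part \<open>frac (x \<bullet> \<alpha>)\<close> reaches the wall and
    \<open>e\<close> goes beyond it; both are below 1.\<close>
  define t where "t = frac (x \<bullet> \<alpha>) + e"
  define x' where "x' = x - (t / (\<alpha> \<bullet> \<alpha>)) *\<^sub>R \<alpha>"
  have x'p: "x' = p + e *\<^sub>R (- ((1 / (\<alpha> \<bullet> \<alpha>)) *\<^sub>R \<alpha>))"
    unfolding x'_def p_def t_def u_def by (simp add: algebra_simps add_divide_distrib)
  have x'a: "x' \<bullet> \<alpha> = of_int \<lfloor>x \<bullet> \<alpha>\<rfloor> - e"
    unfolding x'_def t_def using a0 by (simp add: inner_diff_left frac_def)
  have x'g: "of_int \<lfloor>x \<bullet> \<gamma>\<rfloor> < x' \<bullet> \<gamma>" if "\<gamma> \<in> \<Psi>" "\<gamma> \<noteq> \<alpha>" for \<gamma>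
    using e(3)[OF that] unfolding x'p[symmetric] by (simp add: inner_commute)
  have bt: "of_int \<lfloor>x \<bullet> \<gamma>\<rfloor> < x' \<bullet> \<gamma> \<and> x' \<bullet> \<gamma> < of_int \<lfloor>x \<bullet> \<gamma>\<rfloor> + 1"
    if g: "\<gamma> \<in> \<Psi>" "\<gamma> \<noteq> \<alpha>" "\<gamma> \<noteq> - \<alpha>" for \<gamma>
  proof -
    have "- \<gamma> \<in> \<Psi>" "- \<gamma> \<noteq> \<alpha>" using g P(1) unfolding subsystem_def by auto
    from x'g[OF this] floor_root_uminus[OF P(2) g(1)] have "x' \<bullet> \<gamma> < of_int \<lfloor>x \<bullet> \<gamma>\<rfloor> + 1" by simp
    then show ?thesis using x'g[OF g(1,2)] by blast
  qed
  have ni: "r \<notin> \<int>" if "of_int i < r" "r < of_int i + 1" for r :: real and i :: int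
  proof
    assume "r \<in> \<int>" then obtain j where "r = of_int j" by (auto elim: Ints_cases)
    then have "i < j" "real_of_int j < of_int (i + 1)" using that by simp_all
    then show False by (simp only: of_int_less_iff)
  qed
  have na: "x' \<bullet> \<alpha> \<notin> \<int>" using ni[of "\<lfloor>x \<bullet> \<alpha>\<rfloor> - 1"] x'a e(1,2) by simp
  have "nonint \<Psi> x'" unfolding nonint_def
  proof
    fix \<gamma> assume g: "\<gamma> \<in> \<Psi>"
    consider "\<gamma> = \<alpha>" | "\<gamma> = - \<alpha>" | "\<gamma> \<noteq> \<alpha>" "\<gamma> \<noteq> - \<alpha>" by blast
    then show "x' \<bullet> \<gamma> \<notin> \<int>"
    proof cases
      case 1 then show ?thesis using na by simp
    next
      case 2 then show ?thesis using na by simp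
    next
      case 3 then show ?thesis using bt[OF g] ni by blast
    qed
  qed
  moreover have "\<lfloor>x' \<bullet> \<alpha>\<rfloor> = \<lfloor>x \<bullet> \<alpha>\<rfloor> - 1" unfolding x'a using e(1,2) by linarith
  moreover have "\<lfloor>x' \<bullet> \<beta>\<rfloor> = \<lfloor>x \<bullet> \<beta>\<rfloor>" if "\<beta> \<in> \<Psi>" "\<beta> \<noteq> \<alpha>" "\<beta> \<noteq> - \<alpha>" for \<beta>
    using bt[OF that] by linarith
  moreover have "0 \<le> t" "t \<le> 2" unfolding t_def using e frac_ge_0[of "x \<bullet> \<alpha>"] frac_lt_1[of "x \<bullet> \<alpha>"] by linarith+
  ultimately show ?thesis unfolding x'_def by blast
qed

end

section \<open>Alcoves sharing the walls of a region\<close>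

context root_arrangement
begin

text \<open>
  The point minimizes the sum of the levels over \<open>Q\<close>: crossing a wall whose level is outside the range
  of the arrangement would stay in \<open>R\<close> and decrease that sum.
\<close>

lemma extremal_point:
  assumes R: "R \<in> regions (catalan_arr \<Phi> k)" "dominant pos R"
    and P: "subsystem \<Psi>" "far_points \<Psi> R"
    and Q: "Q = {\<alpha>\<in>\<Psi>. \<alpha> \<bullet> w > 0}"
    and low: "\<And>\<alpha> y. \<alpha> \<in> Q \<Longrightarrow> y \<in> R \<Longrightarrow> B \<le> y \<bullet> \<alpha>"
  shows "\<exists>x\<in>R. nonint \<Psi> x \<and> (\<forall>\<alpha>\<in>Q. int k < \<bar>\<lfloor>x \<bullet> \<alpha>\<rfloor>\<bar> \<longrightarrow> decomposable \<Psi> x \<alpha>)"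
proof -
  have PF: "\<Psi> \<subseteq> \<Phi>" using P(1) unfolding subsystem_def by blast
  have fP: "finite \<Psi>" using PF finite_roots finite_subset by blast
  have fQ: "finite Q" unfolding Q using fP by simp
  \<comment> \<open>Subtracting the lower bound makes every summand nonnegative on \<open>R\<close>,
    so \<open>nat\<close> loses nothing and a minimum exists.\<close>
  define f where "f = (\<lambda>x. nat (\<Sum>\<alpha>\<in>Q. \<lfloor>x \<bullet> \<alpha>\<rfloor> - \<lfloor>B\<rfloor>))"
  have nn: "\<lfloor>x \<bullet> \<alpha>\<rfloor> - \<lfloor>B\<rfloor> \<ge> 0" if "x \<in> R" "\<alpha> \<in> Q" for x \<alpha>
    using floor_mono[OF low[OF that(2,1)]] by simp
  have "0 \<notin> \<Psi>" using PF root_nonzero by blast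
  then obtain x0 where "x0 \<in> R" "nonint \<Psi> x0"
    using exists_nonint_point[OF region_open[OF R(1)] region_nonempty[OF R(1)] fP] unfolding nonint_def by blast
  then obtain x where x: "x \<in> R" "nonint \<Psi> x" and min: "\<And>y. y \<in> R \<Longrightarrow> nonint \<Psi> y \<Longrightarrow> f x \<le> f y"
    using ex_has_least_nat[of "\<lambda>x. x \<in> R \<and> nonint \<Psi> x" x0 f] by blast
  have "decomposable \<Psi> x \<alpha>" if a: "\<alpha> \<in> Q" "int k < \<bar>\<lfloor>x \<bullet> \<alpha>\<rfloor>\<bar>" for \<alpha>
  proof (rule ccontr)
    assume nd: "\<not> decomposable \<Psi> x \<alpha>"
    have aP: "\<alpha> \<in> \<Psi>" using a Q by blast
    \<comment> \<open>The sum bounds the change of every root value under a step with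
      \<open>t \<le> 2\<close>, so positive roots outside \<open>\<Psi>\<close> stay above
      \<open>k\<close>.\<close>
    define C where "C = real k + (\<Sum>\<beta>\<in>\<Phi>. 2 * \<bar>\<alpha> \<bullet> \<beta>\<bar> / (\<alpha> \<bullet> \<alpha>))"
    obtain x' where x': "x' \<in> R" "nonint \<Psi> x'" "\<And>\<beta>. \<beta> \<in> \<Psi> \<Longrightarrow> \<lfloor>x' \<bullet> \<beta>\<rfloor> = \<lfloor>x \<bullet> \<beta>\<rfloor>"
        "\<And>\<beta>. \<beta> \<in> pos - \<Psi> \<Longrightarrow> C < x' \<bullet> \<beta>"
      using P(2) x unfolding far_points_def by blast
    have nd': "\<not> decomposable \<Psi> x' \<alpha>" using decomposable_cong[of \<Psi> x' x \<alpha>] x'(3) nd aP by blast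
    obtain t where t: "0 \<le> t" "t \<le> 2" and y0: "nonint \<Psi> (x' - (t / (\<alpha> \<bullet> \<alpha>)) *\<^sub>R \<alpha>)"
        "\<lfloor>(x' - (t / (\<alpha> \<bullet> \<alpha>)) *\<^sub>R \<alpha>) \<bullet> \<alpha>\<rfloor> = \<lfloor>x' \<bullet> \<alpha>\<rfloor> - 1"
        "\<forall>\<beta>\<in>\<Psi>. \<beta> \<noteq> \<alpha> \<longrightarrow> \<beta> \<noteq> - \<alpha> \<longrightarrow> \<lfloor>(x' - (t / (\<alpha> \<bullet> \<alpha>)) *\<^sub>R \<alpha>) \<bullet> \<beta>\<rfloor> = \<lfloor>x' \<bullet> \<beta>\<rfloor>"
      using cross_indecomposable[OF P(1) x'(2) aP nd'] by blast
    define y where "y = x' - (t / (\<alpha> \<bullet> \<alpha>)) *\<^sub>R \<alpha>"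
    have y: "nonint \<Psi> y" "\<lfloor>y \<bullet> \<alpha>\<rfloor> = \<lfloor>x \<bullet> \<alpha>\<rfloor> - 1"
        "\<And>\<beta>. \<beta> \<in> \<Psi> \<Longrightarrow> \<beta> \<noteq> \<alpha> \<Longrightarrow> \<beta> \<noteq> - \<alpha> \<Longrightarrow> \<lfloor>y \<bullet> \<beta>\<rfloor> = \<lfloor>x \<bullet> \<beta>\<rfloor>"
      using y0 x'(3) aP unfolding y_def by auto
    have far: "real k < y \<bullet> \<beta>" if b: "\<beta> \<in> pos - \<Psi>" for \<beta>
    proof -
      have bF: "\<beta> \<in> \<Phi>" using b unfolding pos_def by blast
      have "t * (\<alpha> \<bullet> \<beta>) / (\<alpha> \<bullet> \<alpha>) \<le> 2 * \<bar>\<alpha> \<bullet> \<beta>\<bar> / (\<alpha> \<bullet> \<alpha>)"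
      proof (rule divide_right_mono)
        have "t * (\<alpha> \<bullet> \<beta>) \<le> t * \<bar>\<alpha> \<bullet> \<beta>\<bar>" using t(1) by (intro mult_left_mono) auto
        also have "\<dots> \<le> 2 * \<bar>\<alpha> \<bullet> \<beta>\<bar>" using t(2) by (intro mult_right_mono) auto
        finally show "t * (\<alpha> \<bullet> \<beta>) \<le> 2 * \<bar>\<alpha> \<bullet> \<beta>\<bar>" .
      qed simp
      also have "\<dots> \<le> (\<Sum>\<beta>\<in>\<Phi>. 2 * \<bar>\<alpha> \<bullet> \<beta>\<bar> / (\<alpha> \<bullet> \<alpha>))"
        by (rule member_le_sum[OF bF]) (use finite_roots in auto)
      finally show ?thesis using x'(4)[OF b] unfolding C_def y_def by (simp add: inner_diff_left)
    qed
    have yi: "of_int i < y \<bullet> \<beta> \<longleftrightarrow> i \<le> \<lfloor>y \<bullet> \<beta>\<rfloor>" if "\<beta> \<in> \<Psi>" for i \<beta>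
    proof -
      have "y \<bullet> \<beta> \<noteq> of_int i" using y(1) that Ints_of_int unfolding nonint_def by metis
      then show ?thesis by linarith
    qed
    have xi: "of_int i < x' \<bullet> \<beta> \<longleftrightarrow> i \<le> \<lfloor>x \<bullet> \<beta>\<rfloor>" if "\<beta> \<in> \<Psi>" for i \<beta>
    proof -
      have "x' \<bullet> \<beta> \<noteq> of_int i" using x'(2) that Ints_of_int unfolding nonint_def by metis
      then show ?thesis using x'(3)[OF that] by linarith
    qed
    have na: "- \<alpha> \<in> \<Psi>" using aP P(1) unfolding subsystem_def by blast
    have "of_int i < x' \<bullet> \<beta> \<longleftrightarrow> of_int i < y \<bullet> \<beta>" if b: "\<beta> \<in> \<Phi>" "\<bar>i\<bar> \<le> int k" for \<beta> i
    proof -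
      consider "\<beta> = \<alpha>" | "\<beta> = - \<alpha>" | "\<beta> \<in> \<Psi>" "\<beta> \<noteq> \<alpha>" "\<beta> \<noteq> - \<alpha>" | "\<beta> \<in> pos - \<Psi>" | "- \<beta> \<in> pos - \<Psi>"
        using pos_or_neg[OF b(1)] P(1) unfolding subsystem_def by (metis DiffI minus_minus)
      then show ?thesis
      proof cases
        case 1 then show ?thesis using xi[OF aP] yi[OF aP] y(2) a(2) b(2) by auto
      next
        case 2
        have "\<lfloor>y \<bullet> (- \<alpha>)\<rfloor> = - \<lfloor>x \<bullet> \<alpha>\<rfloor>" using floor_root_uminus[OF y(1) aP] y(2) by simp
        moreover have "\<lfloor>x \<bullet> (- \<alpha>)\<rfloor> = - \<lfloor>x \<bullet> \<alpha>\<rfloor> - 1" using floor_root_uminus[OF x(2) aP] .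
        \<comment> \<open>The two tests differ only at
          \<open>i = - \<lfloor>x \<bullet> \<alpha>\<rfloor>\<close>, which is out of
          range.\<close>
        moreover have "i \<le> - \<lfloor>x \<bullet> \<alpha>\<rfloor> - 1 \<longleftrightarrow> i \<le> - \<lfloor>x \<bullet> \<alpha>\<rfloor>" using a(2) b(2) by arith
        ultimately show ?thesis using xi[OF na, of i] yi[OF na, of i] unfolding 2 by metis
      next
        case 3 then show ?thesis using xi yi y(3) by simp
      next
        case 4
        have "C \<ge> real k" unfolding C_def by (simp add: sum_nonneg)
        moreover have "real_of_int i \<le> real k" using b(2) by linarith
        ultimately show ?thesis using far[OF 4] x'(4)[OF 4] by linarith
      next
        case 5
        have "C \<ge> real k" unfolding C_def by (simp add: sum_nonneg)
        moreover have "- real_of_int i \<le> real k" using b(2) by linarith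
        ultimately show ?thesis using far[OF 5] x'(4)[OF 5] by simp
      qed
    qed
    then have "same_side x' y" unfolding same_side_def by blast
    then have yR: "y \<in> R" using region_eq(2)[OF R(1) x'(1)] by blast
    have "(\<Sum>\<beta>\<in>Q. \<lfloor>y \<bullet> \<beta>\<rfloor> - \<lfloor>B\<rfloor>) < (\<Sum>\<beta>\<in>Q. \<lfloor>x \<bullet> \<beta>\<rfloor> - \<lfloor>B\<rfloor>)"
    proof (rule sum_strict_mono_ex1[OF fQ])
      have na: "- \<alpha> \<notin> Q" using a(1) unfolding Q by auto
      have "\<lfloor>y \<bullet> \<beta>\<rfloor> \<le> \<lfloor>x \<bullet> \<beta>\<rfloor>" if b: "\<beta> \<in> Q" for \<beta>
      proof -
        have "\<beta> \<noteq> - \<alpha>" "\<beta> \<in> \<Psi>" using na b Q by auto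
        then show ?thesis using y(2) y(3)[of \<beta>] by (cases "\<beta> = \<alpha>") auto
      qed
      then show "\<forall>\<beta>\<in>Q. \<lfloor>y \<bullet> \<beta>\<rfloor> - \<lfloor>B\<rfloor> \<le> \<lfloor>x \<bullet> \<beta>\<rfloor> - \<lfloor>B\<rfloor>" by simp
      show "\<exists>\<beta>\<in>Q. \<lfloor>y \<bullet> \<beta>\<rfloor> - \<lfloor>B\<rfloor> < \<lfloor>x \<bullet> \<beta>\<rfloor> - \<lfloor>B\<rfloor>" using a(1) y(2) by (intro bexI[of _ \<alpha>]) auto
    qed
    moreover have "(\<Sum>\<beta>\<in>Q. \<lfloor>y \<bullet> \<beta>\<rfloor> - \<lfloor>B\<rfloor>) \<ge> 0" using nn[OF yR] by (rule sum_nonneg)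
    ultimately have "f y < f x" unfolding f_def by simp
    then show False using min[OF yR y(1)] by simp
  qed
  then show ?thesis using x by blast
qed

text \<open>Once the levels at \<open>x\<close> are lower bounds on all of \<open>R\<close>, a
  decomposition of \<open>\<alpha>\<close> writes the wall as a sum of two affine roots positive on
  \<open>R\<close>, which \<open>wall_not_sum\<close> forbids. \<open>regroup\<close> supplies
  decompositions whose parts have such bounds.\<close>

lemma wall_indecomposable:
  assumes R: "R \<in> regions (catalan_arr \<Phi> k)" "dominant pos R" and xR: "x \<in> R"
    and P: "subsystem \<Psi>" "nonint \<Psi> x" and Q: "Q = {\<alpha>\<in>\<Psi>. \<alpha> \<bullet> w > 0}" "w = v \<or> w = - v"
    and dec: "\<And>\<alpha>. \<alpha> \<in> Q \<Longrightarrow> int k < \<bar>\<lfloor>x \<bullet> \<alpha>\<rfloor>\<bar> \<Longrightarrow> decomposable \<Psi> x \<alpha>"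
    and a: "\<alpha> \<in> Q" "\<bar>i\<bar> \<le> int k" "wall (catalan_arr \<Phi> k) R (hyp \<alpha> (of_int i))" "\<And>y. y \<in> R \<Longrightarrow> of_int i < y \<bullet> \<alpha>"
  shows "\<lfloor>x \<bullet> \<alpha>\<rfloor> = i \<and> \<not> decomposable \<Psi> x \<alpha>"
proof -
  have PF: "\<Psi> \<subseteq> \<Phi>" using P(1) unfolding subsystem_def by blast
  have QP: "\<beta> \<in> \<Psi>" "\<beta> \<in> \<Phi>" "\<beta> \<bullet> w > 0" if "\<beta> \<in> Q" for \<beta> using that Q PF by auto
  have fQ: "finite Q" using finite_roots PF finite_subset unfolding Q by fastforce
  have sign: "(\<forall>\<beta>\<in>Q. \<lfloor>x \<bullet> \<beta>\<rfloor> \<ge> 0) \<or> (\<forall>\<beta>\<in>Q. \<lfloor>x \<bullet> \<beta>\<rfloor> < 0)"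
    using Q(2)
  proof
    assume "w = v"
    then have "\<lfloor>x \<bullet> \<beta>\<rfloor> \<ge> 0" if "\<beta> \<in> Q" for \<beta>
      using R(2) xR QP[OF that] unfolding dominant_def pos_def by (simp add: less_imp_le)
    then show ?thesis by blast
  next
    assume w: "w = - v"
    have "\<lfloor>x \<bullet> \<beta>\<rfloor> < 0" if "\<beta> \<in> Q" for \<beta>
    proof -
      have "- \<beta> \<in> pos" using QP[OF that] root_uminus[OF crys] w unfolding pos_def by auto
      then show ?thesis using R(2) xR unfolding dominant_def by fastforce
    qed
    then show ?thesis by blast
  qed
  define Hi where "Hi = {\<beta>\<in>Q. int k < \<bar>\<lfloor>x \<bullet> \<beta>\<rfloor>\<bar>}"
  have HiQ: "Hi \<subseteq> Q" unfolding Hi_def by blast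
  have up: "\<beta> + \<gamma> \<in> Hi" if bg: "\<beta> \<in> Hi" "\<gamma> \<in> Q" "\<beta> + \<gamma> \<in> Q" for \<beta> \<gamma>
  proof -
    have b: "\<beta> \<in> Q" "int k < \<bar>\<lfloor>x \<bullet> \<beta>\<rfloor>\<bar>" using bg(1) unfolding Hi_def by auto
    have "(\<lfloor>x \<bullet> \<beta>\<rfloor> \<ge> 0 \<and> \<lfloor>x \<bullet> \<gamma>\<rfloor> \<ge> 0) \<or> (\<lfloor>x \<bullet> \<beta>\<rfloor> < 0 \<and> \<lfloor>x \<bullet> \<gamma>\<rfloor> < 0)" using sign b(1) bg(2) by blast
    \<comment> \<open>For negative levels a possible carry 1 is absorbed, because the level of
      \<open>\<gamma>\<close> is at most -1.\<close>
    then have "int k < \<bar>\<lfloor>x \<bullet> (\<beta> + \<gamma>)\<rfloor>\<bar>" using floor_root_add[of x \<beta> \<gamma>] b(2) by arith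
    then show ?thesis using bg(3) unfolding Hi_def by blast
  qed
  have Hd: "decomposable \<Psi> x \<beta>" if "\<beta> \<in> Hi" for \<beta> using dec that unfolding Hi_def by blast
  have reg: "(\<exists>\<mu>\<in>Q. \<exists>\<nu>\<in>Q. \<beta> = \<mu> + \<nu> \<and> \<lfloor>x \<bullet> \<beta>\<rfloor> = \<lfloor>x \<bullet> \<mu>\<rfloor> + \<lfloor>x \<bullet> \<nu>\<rfloor>) \<or>
      (\<exists>\<gamma>\<in>Q. \<beta> + \<gamma> \<in> Q \<and> \<beta> + \<gamma> \<notin> Hi \<and> \<lfloor>x \<bullet> (\<beta> + \<gamma>)\<rfloor> = \<lfloor>x \<bullet> \<beta>\<rfloor> + \<lfloor>x \<bullet> \<gamma>\<rfloor> + 1)"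
    if "\<beta> \<in> Q" "decomposable \<Psi> x \<beta>" for \<beta>
    using regroup[OF P Q HiQ _ _ that] up Hd by blast
  have xni: "x \<bullet> \<beta> \<noteq> of_int j" if "\<beta> \<in> \<Psi>" for \<beta> j using P(2) that Ints_of_int unfolding nonint_def by metis
  have lowlev: "of_int \<lfloor>x \<bullet> \<beta>\<rfloor> < y \<bullet> \<beta>" if "y \<in> R" "\<beta> \<in> \<Psi>" "\<bar>\<lfloor>x \<bullet> \<beta>\<rfloor>\<bar> \<le> int k" for y \<beta>
  proof -
    have "of_int \<lfloor>x \<bullet> \<beta>\<rfloor> < x \<bullet> \<beta>" using xni[OF that(2), of "\<lfloor>x \<bullet> \<beta>\<rfloor>"] by linarith
    then show ?thesis using region_side[OF R(1) xR that(1) _ that(3)] that(2) PF by blast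
  qed
  \<comment> \<open>Levels in range are seen by the arrangement. A root of \<open>Hi\<close> splits
    inside \<open>Q\<close> into roots of smaller height, since \<open>up\<close> excludes the other
    alternative of \<open>reg\<close>.\<close>
  have lower: "of_int \<lfloor>x \<bullet> \<beta>\<rfloor> < y \<bullet> \<beta>" if y: "y \<in> R" and b: "\<beta> \<in> Q" for y \<beta>
    using b
  proof (induction "card {\<delta>\<in>Q. \<delta> \<bullet> w < \<beta> \<bullet> w}" arbitrary: \<beta> rule: less_induct)
    case less
    show ?case
    proof (cases "\<beta> \<in> Hi")
      case False
      then show ?thesis using lowlev[OF y QP(1)[OF less(2)]] less(2) unfolding Hi_def by auto
    next
      case True
      then obtain \<mu> \<nu> where mn: "\<mu> \<in> Q" "\<nu> \<in> Q" "\<beta> = \<mu> + \<nu>" "\<lfloor>x \<bullet> \<beta>\<rfloor> = \<lfloor>x \<bullet> \<mu>\<rfloor> + \<lfloor>x \<bullet> \<nu>\<rfloor>"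
        using reg[OF less(2) Hd[OF True]] up[OF True] by blast
      have card: "card {\<delta>\<in>Q. \<delta> \<bullet> w < \<mu> \<bullet> w} < card {\<delta>\<in>Q. \<delta> \<bullet> w < \<beta> \<bullet> w}" if "\<mu> \<in> Q" "\<mu> \<bullet> w < \<beta> \<bullet> w" for \<mu>
        using that fQ by (intro psubset_card_mono) auto
      have "\<mu> \<bullet> w < \<beta> \<bullet> w" "\<nu> \<bullet> w < \<beta> \<bullet> w" using QP(3)[OF mn(1)] QP(3)[OF mn(2)] unfolding mn(3) by (simp_all add: inner_add_left)
      then have "of_int \<lfloor>x \<bullet> \<mu>\<rfloor> < y \<bullet> \<mu>" "of_int \<lfloor>x \<bullet> \<nu>\<rfloor> < y \<bullet> \<nu>" using less(1)[OF card] mn(1,2) by blast+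
      then show ?thesis unfolding mn(4) unfolding mn(3) by (simp add: inner_add_right)
    qed
  qed
  have aP: "\<alpha> \<in> \<Psi>" "\<alpha> \<in> \<Phi>" using QP a(1) by auto
  have fl: "\<lfloor>x \<bullet> \<alpha>\<rfloor> = i"
  proof (rule ccontr)
    assume "\<lfloor>x \<bullet> \<alpha>\<rfloor> \<noteq> i"
    moreover have "\<lfloor>x \<bullet> \<alpha>\<rfloor> \<ge> i" using a(4)[OF xR] by linarith
    ultimately have gt: "\<lfloor>x \<bullet> \<alpha>\<rfloor> \<ge> i + 1" by linarith
    \<comment> \<open>A larger level would keep \<open>R\<close> at or above \<open>i + 1\<close>
      and its closure off the wall.\<close>
    have "R \<subseteq> {y. \<alpha> \<bullet> y \<ge> of_int (i + 1)}"
    proof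
      fix y assume "y \<in> R"
      from lower[OF this a(1)] gt show "y \<in> {y. \<alpha> \<bullet> y \<ge> of_int (i + 1)}" by (simp add: inner_commute)
    qed
    then have "closure R \<subseteq> {y. \<alpha> \<bullet> y \<ge> of_int (i + 1)}" by (intro closure_minimal closed_halfspace_ge)
    moreover have "closure R \<inter> hyp \<alpha> (of_int i) \<noteq> {}" using a(3) unfolding wall_def facet_of_def by blast
    then obtain y where "y \<in> closure R" "y \<bullet> \<alpha> = of_int i" unfolding hyp_def by blast
    ultimately show False by (auto simp: inner_commute)
  qed
  moreover have "\<not> decomposable \<Psi> x \<alpha>"
  proof
    assume "decomposable \<Psi> x \<alpha>"
    from reg[OF a(1) this] show False
    proof
      assume "\<exists>\<beta>\<in>Q. \<exists>\<gamma>\<in>Q. \<alpha> = \<beta> + \<gamma> \<and> \<lfloor>x \<bullet> \<alpha>\<rfloor> = \<lfloor>x \<bullet> \<beta>\<rfloor> + \<lfloor>x \<bullet> \<gamma>\<rfloor>"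
      then obtain \<beta> \<gamma> where bg: "\<beta> \<in> Q" "\<gamma> \<in> Q" "\<alpha> = \<beta> + \<gamma>" "\<lfloor>x \<bullet> \<alpha>\<rfloor> = \<lfloor>x \<bullet> \<beta>\<rfloor> + \<lfloor>x \<bullet> \<gamma>\<rfloor>" by blast
      have "wall (catalan_arr \<Phi> k) R (hyp \<alpha> (of_int \<lfloor>x \<bullet> \<beta>\<rfloor> + of_int \<lfloor>x \<bullet> \<gamma>\<rfloor>))" using a(3) bg(4) fl by simp
      from wall_not_sum[OF R(1) this aP(2) QP(2)[OF bg(1)] QP(2)[OF bg(2)] bg(3)] lower bg(1,2)
      show False by blast
    next
      assume "\<exists>\<gamma>\<in>Q. \<alpha> + \<gamma> \<in> Q \<and> \<alpha> + \<gamma> \<notin> Hi \<and> \<lfloor>x \<bullet> (\<alpha> + \<gamma>)\<rfloor> = \<lfloor>x \<bullet> \<alpha>\<rfloor> + \<lfloor>x \<bullet> \<gamma>\<rfloor> + 1"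
      then obtain \<gamma> where g: "\<gamma> \<in> Q" "\<alpha> + \<gamma> \<in> Q" "\<alpha> + \<gamma> \<notin> Hi" "\<lfloor>x \<bullet> (\<alpha> + \<gamma>)\<rfloor> = \<lfloor>x \<bullet> \<alpha>\<rfloor> + \<lfloor>x \<bullet> \<gamma>\<rfloor> + 1" by blast
      have ng: "- \<gamma> \<in> \<Psi>" using QP(1)[OF g(1)] P(1) unfolding subsystem_def by blast
      have fng: "\<lfloor>x \<bullet> (- \<gamma>)\<rfloor> = - \<lfloor>x \<bullet> \<gamma>\<rfloor> - 1" using floor_root_uminus[OF P(2) QP(1)[OF g(1)]] .
      have le: "\<bar>\<lfloor>x \<bullet> (\<alpha> + \<gamma>)\<rfloor>\<bar> \<le> int k" using g(2,3) unfolding Hi_def by auto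
      \<comment> \<open>The root \<open>- \<gamma>\<close> is outside \<open>Q\<close>, so
        \<open>lower\<close> does not cover it. As \<open>\<alpha> + \<gamma>\<close> is not in
        \<open>Hi\<close> and all levels on \<open>Q\<close> have one sign, its level is in range
        and \<open>lowlev\<close> applies.\<close>
      have "\<bar>\<lfloor>x \<bullet> (- \<gamma>)\<rfloor>\<bar> \<le> int k" using sign le g(4) unfolding fng
      proof (elim disjE)
        assume "\<forall>\<beta>\<in>Q. \<lfloor>x \<bullet> \<beta>\<rfloor> \<ge> 0"
        then have "\<lfloor>x \<bullet> \<alpha>\<rfloor> \<ge> 0" "\<lfloor>x \<bullet> \<gamma>\<rfloor> \<ge> 0" using a(1) g(1) by blast+
        then show "\<bar>- \<lfloor>x \<bullet> \<gamma>\<rfloor> - 1\<bar> \<le> int k" using le g(4) by linarith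
      next
        assume "\<forall>\<beta>\<in>Q. \<lfloor>x \<bullet> \<beta>\<rfloor> < 0"
        then have "\<lfloor>x \<bullet> \<alpha>\<rfloor> < 0" "\<lfloor>x \<bullet> \<gamma>\<rfloor> < 0" using a(1) g(1) by blast+
        then show "\<bar>- \<lfloor>x \<bullet> \<gamma>\<rfloor> - 1\<bar> \<le> int k" using le g(4) by linarith
      qed
      then have lo: "of_int \<lfloor>x \<bullet> (- \<gamma>)\<rfloor> < y \<bullet> (- \<gamma>)" if "y \<in> R" for y using lowlev[OF that ng] by blast
      have "\<lfloor>x \<bullet> \<alpha>\<rfloor> = \<lfloor>x \<bullet> (\<alpha> + \<gamma>)\<rfloor> + \<lfloor>x \<bullet> (- \<gamma>)\<rfloor>" using g(4) fng by simp
      then have "of_int i = of_int \<lfloor>x \<bullet> (\<alpha> + \<gamma>)\<rfloor> + real_of_int \<lfloor>x \<bullet> (- \<gamma>)\<rfloor>" using fl by simp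
      then have "wall (catalan_arr \<Phi> k) R (hyp \<alpha> (of_int \<lfloor>x \<bullet> (\<alpha> + \<gamma>)\<rfloor> + of_int \<lfloor>x \<bullet> (- \<gamma>)\<rfloor>))" using a(3) by simp
      from wall_not_sum[OF R(1) this aP(2) QP(2)[OF g(2)] _ _ lower[OF _ g(2)] lo] show False using ng PF by auto
    qed
  qed
  ultimately show ?thesis by blast
qed

text \<open>The extremal point shows that \<open>S\<close> consists of walls of one
  \<open>\<Psi>\<close>-alcove. A far point of that alcove is projected in its place, so that
  positive roots outside \<open>\<Psi>\<close> remain above \<open>k\<close> at
  \<open>p\<close>.\<close>

lemma cross_walls:
  fixes \<kappa> :: "'a \<Rightarrow> int"
  assumes R: "R \<in> regions (catalan_arr \<Phi> k)" "dominant pos R"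
    and P: "subsystem \<Psi>" "far_points \<Psi> R"
    and w: "w = v \<or> w = - v"
    and low: "\<And>\<alpha> y. \<alpha> \<in> \<Psi> \<Longrightarrow> \<alpha> \<bullet> w > 0 \<Longrightarrow> y \<in> R \<Longrightarrow> B \<le> y \<bullet> \<alpha>"
    and S: "\<And>b. b \<in> S \<Longrightarrow> b \<in> \<Psi> \<and> b \<bullet> w > 0 \<and> \<bar>\<kappa> b\<bar> \<le> int k \<and> wall (catalan_arr \<Phi> k) R (hyp b (of_int (\<kappa> b)))"
    and ab: "\<And>b y. b \<in> S \<Longrightarrow> y \<in> R \<Longrightarrow> of_int (\<kappa> b) < y \<bullet> b"
    and sgn: "(\<forall>b\<in>S. \<kappa> b > 0) \<or> (\<forall>b\<in>S. \<kappa> b < 0)"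
  shows "\<exists>R'\<in>regions (catalan_arr \<Phi> k). dominant pos R' \<and>
    crossing {y. \<forall>b\<in>S. y \<bullet> b = of_int (\<kappa> b)} R R' \<and>
    (\<forall>b\<in>S. wall (catalan_arr \<Phi> k) R' (hyp b (of_int (\<kappa> b))) \<and> (\<forall>y\<in>R'. y \<bullet> b < of_int (\<kappa> b)))"
proof -
  define Q where "Q = {\<alpha>\<in>\<Psi>. \<alpha> \<bullet> w > 0}"
  have PF: "\<Psi> \<subseteq> \<Phi>" using P(1) unfolding subsystem_def by blast
  have SP: "S \<subseteq> \<Psi>" using S by blast
  have fS: "finite S" using SP PF finite_roots finite_subset by metis
  obtain x where x: "x \<in> R" "nonint \<Psi> x" and dec: "\<And>\<alpha>. \<alpha> \<in> Q \<Longrightarrow> int k < \<bar>\<lfloor>x \<bullet> \<alpha>\<rfloor>\<bar> \<Longrightarrow> decomposable \<Psi> x \<alpha>"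
    using extremal_point[OF R P Q_def, of B] low unfolding Q_def by blast
  have ind: "\<lfloor>x \<bullet> b\<rfloor> = \<kappa> b \<and> \<not> decomposable \<Psi> x b" if b: "b \<in> S" for b
    by (rule wall_indecomposable[OF R x(1) P(1) x(2) Q_def w dec]) (use S[OF b] ab[OF b] Q_def in auto)
  have "obtuse S" unfolding obtuse_def using indecomposable_obtuse[OF P(1) x(2)] ind SP by blast
  then have "independent S" using obtuse_independent[OF fS, of w] S by blast
  then obtain u where u: "\<And>a. a \<in> S \<Longrightarrow> u a \<in> span S"
      "\<And>a b. a \<in> S \<Longrightarrow> b \<in> S \<Longrightarrow> u a \<bullet> b = (if a = b then 1 else 0)"
    using dual_family_exists[of S] by blast
  \<comment> \<open>The coefficients in the projection are fractional parts, below 1, so the sum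
    bounds the change of any root value.\<close>
  define C where "C = real k + (\<Sum>\<beta>\<in>\<Phi>. \<Sum>a\<in>S. \<bar>u a \<bullet> \<beta>\<bar>)"
  obtain x' where x': "x' \<in> R" "nonint \<Psi> x'" "\<And>\<beta>. \<beta> \<in> \<Psi> \<Longrightarrow> \<lfloor>x' \<bullet> \<beta>\<rfloor> = \<lfloor>x \<bullet> \<beta>\<rfloor>"
      "\<And>\<beta>. \<beta> \<in> pos - \<Psi> \<Longrightarrow> C < x' \<bullet> \<beta>"
    using P(2) x unfolding far_points_def by blast
  have ind': "\<lfloor>x' \<bullet> b\<rfloor> = \<kappa> b" "\<not> decomposable \<Psi> x' b" if b: "b \<in> S" for b
    using ind[OF b] x'(3) decomposable_cong[of \<Psi> x' x b] b SP by auto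
  define p where "p = x' - (\<Sum>a\<in>S. frac (x' \<bullet> a) *\<^sub>R u a)"
  have pb: "p \<bullet> b = of_int \<lfloor>x' \<bullet> b\<rfloor>" if "b \<in> S" for b
    by (rule projection_to_face(1)[OF P(1) x'(2) SP _ u p_def that]) (use ind' in auto)
  have pg: "of_int \<lfloor>x' \<bullet> \<gamma>\<rfloor> \<le> p \<bullet> \<gamma> \<and> (p \<bullet> \<gamma> = of_int \<lfloor>x' \<bullet> \<gamma>\<rfloor> \<longrightarrow>
      (\<exists>c::'a\<Rightarrow>real. (\<forall>b\<in>S. c b \<ge> 0) \<and> \<gamma> = (\<Sum>b\<in>S. c b *\<^sub>R b) \<and>
        of_int \<lfloor>x' \<bullet> \<gamma>\<rfloor> = (\<Sum>b\<in>S. c b * of_int \<lfloor>x' \<bullet> b\<rfloor>)))" if "\<gamma> \<in> \<Psi>" for \<gamma>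
    by (rule projection_to_face(2)[OF P(1) x'(2) SP _ u p_def that]) (use ind' in auto)
  have C: "C \<ge> real k" unfolding C_def by (simp add: sum_nonneg)
  have far: "real k < p \<bullet> \<beta>" if b: "\<beta> \<in> pos - \<Psi>" for \<beta>
  proof -
    have bF: "\<beta> \<in> \<Phi>" using b unfolding pos_def by blast
    have "(\<Sum>a\<in>S. frac (x' \<bullet> a) *\<^sub>R u a) \<bullet> \<beta> \<le> (\<Sum>a\<in>S. \<bar>u a \<bullet> \<beta>\<bar>)"
      unfolding inner_sum_left inner_scaleR_left
    proof (rule sum_mono)
      fix a
      have "frac (x' \<bullet> a) * (u a \<bullet> \<beta>) \<le> frac (x' \<bullet> a) * \<bar>u a \<bullet> \<beta>\<bar>" by (intro mult_left_mono) auto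
      also have "\<dots> \<le> 1 * \<bar>u a \<bullet> \<beta>\<bar>" using frac_lt_1[of "x' \<bullet> a"] by (intro mult_right_mono) auto
      finally show "frac (x' \<bullet> a) * (u a \<bullet> \<beta>) \<le> \<bar>u a \<bullet> \<beta>\<bar>" by simp
    qed
    also have "\<dots> \<le> (\<Sum>\<beta>\<in>\<Phi>. \<Sum>a\<in>S. \<bar>u a \<bullet> \<beta>\<bar>)"
      by (rule member_le_sum[OF bF]) (use finite_roots in \<open>auto intro: sum_nonneg\<close>)
    finally show ?thesis using x'(4)[OF b] unfolding C_def p_def by (simp add: inner_diff_left)
  qed
  have cases: "(\<gamma> \<in> \<Psi> \<and> i \<le> \<lfloor>x' \<bullet> \<gamma>\<rfloor>) \<or> of_int i < p \<bullet> \<gamma>"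
    if g: "\<gamma> \<in> \<Phi>" "\<bar>i\<bar> \<le> int k" "of_int i < x' \<bullet> \<gamma>" for \<gamma> i
  proof -
    consider "\<gamma> \<in> \<Psi>" | "\<gamma> \<in> pos - \<Psi>" | "- \<gamma> \<in> pos - \<Psi>"
      using pos_or_neg[OF g(1)] P(1) unfolding subsystem_def by (metis DiffI minus_minus)
    then show ?thesis
    proof cases
      case 1 then show ?thesis using g(3) by linarith
    next
      case 2
      have "real_of_int i \<le> real k" using g(2) by linarith
      then show ?thesis using far[OF 2] by linarith
    next
      case 3
      have "- real_of_int i \<le> real k" using g(2) by linarith
      then show ?thesis using x'(4)[OF 3] C g(3) by simp
    qed
  qed
  show ?thesis
  proof (rule opposite_region[OF R(1) x'(1) _ u(2), where p = p])
    show "S \<subseteq> \<Phi>" using SP PF by blast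
    show "\<bar>\<kappa> b\<bar> \<le> int k" if "b \<in> S" for b using S[OF that] by blast
    show "p \<bullet> b = of_int (\<kappa> b)" if "b \<in> S" for b using pb[OF that] ind'(1)[OF that] by simp
    show "of_int (\<kappa> b) < x' \<bullet> b" if "b \<in> S" for b using ab[OF that x'(1)] .
    show "of_int i \<le> p \<bullet> \<gamma>" if g: "\<gamma> \<in> \<Phi>" "\<bar>i\<bar> \<le> int k" "of_int i < x' \<bullet> \<gamma>" for \<gamma> i
      using cases[OF g]
    proof
      assume h: "\<gamma> \<in> \<Psi> \<and> i \<le> \<lfloor>x' \<bullet> \<gamma>\<rfloor>"
      then have "real_of_int i \<le> of_int \<lfloor>x' \<bullet> \<gamma>\<rfloor>" by simp
      then show ?thesis using pg[of \<gamma>] h by linarith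
    qed simp
    show "\<exists>c::'a\<Rightarrow>real. (\<forall>b\<in>S. c b \<ge> 0) \<and> \<gamma> = (\<Sum>b\<in>S. c b *\<^sub>R b) \<and> of_int i = (\<Sum>b\<in>S. c b * of_int (\<kappa> b))"
      if g: "\<gamma> \<in> \<Phi>" "\<bar>i\<bar> \<le> int k" "of_int i < x' \<bullet> \<gamma>" "p \<bullet> \<gamma> = of_int i" for \<gamma> i
    proof -
      \<comment> \<open>Equality at \<open>p\<close> excludes the far case, and then the level is
        squeezed between \<open>i\<close> and \<open>p \<bullet> \<gamma>\<close>.\<close>
      have h: "\<gamma> \<in> \<Psi>" "i \<le> \<lfloor>x' \<bullet> \<gamma>\<rfloor>" using cases[OF g(1-3)] g(4) by auto
      have "real_of_int \<lfloor>x' \<bullet> \<gamma>\<rfloor> \<le> of_int i" using pg[OF h(1)] g(4) by simp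
      then have "\<lfloor>x' \<bullet> \<gamma>\<rfloor> \<le> i" by (simp only: of_int_le_iff)
      then have fl: "\<lfloor>x' \<bullet> \<gamma>\<rfloor> = i" using h(2) by simp
      then obtain c :: "'a \<Rightarrow> real" where c: "\<forall>b\<in>S. c b \<ge> 0" "\<gamma> = (\<Sum>b\<in>S. c b *\<^sub>R b)"
        "of_int i = (\<Sum>b\<in>S. c b * of_int \<lfloor>x' \<bullet> b\<rfloor>)" using pg[OF h(1)] g(4) by auto
      moreover have "(\<Sum>b\<in>S. c b * of_int \<lfloor>x' \<bullet> b\<rfloor>) = (\<Sum>b\<in>S. c b * of_int (\<kappa> b))"
        by (rule sum.cong) (use ind'(1) in auto)
      ultimately show ?thesis by (intro exI[of _ c]) simp
    qed
  qed (use R(2) sgn in auto)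
qed

end

section \<open>The bijection\<close>

text \<open>Along the segment the inner product with \<open>\<alpha>\<close> runs linearly from 0 to
  \<open>y \<bullet> \<alpha>\<close>. This turns the conditions in \<open>floor_wall\<close> and
  \<open>ceiling\<close> into inequalities.\<close>

lemma segment_meets_hyp_iff:
  assumes "i > 0"
  shows "closed_segment 0 y \<inter> hyp \<alpha> i \<noteq> {} \<longleftrightarrow> i \<le> y \<bullet> \<alpha>"
proof
  assume "closed_segment 0 y \<inter> hyp \<alpha> i \<noteq> {}"
  then obtain z where "z \<in> closed_segment 0 y" "z \<bullet> \<alpha> = i" unfolding hyp_def by blast
  then obtain t where t: "0 \<le> t" "t \<le> 1" "t * (y \<bullet> \<alpha>) = i"
    unfolding in_segment by auto
  have "y \<bullet> \<alpha> > 0" using t assms by (metis mult_nonneg_nonpos not_le)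
  then have "t * (y \<bullet> \<alpha>) \<le> 1 * (y \<bullet> \<alpha>)" using t by (intro mult_right_mono) auto
  then show "i \<le> y \<bullet> \<alpha>" using t by simp
next
  assume a: "i \<le> y \<bullet> \<alpha>"
  then have "(i / (y \<bullet> \<alpha>)) *\<^sub>R y \<in> closed_segment 0 y \<inter> hyp \<alpha> i"
    unfolding closed_segment_def hyp_def using assms by (auto intro!: exI[of _ "i / (y \<bullet> \<alpha>)"])
  then show "closed_segment 0 y \<inter> hyp \<alpha> i \<noteq> {}" by blast
qed

lemma bij_betw_of_unique_partners:
  assumes "\<And>x. x \<in> X \<Longrightarrow> \<exists>y\<in>Y. T x y" "\<And>y. y \<in> Y \<Longrightarrow> \<exists>x\<in>X. T x y"
    and "\<And>x y y'. x \<in> X \<Longrightarrow> y \<in> Y \<Longrightarrow> y' \<in> Y \<Longrightarrow> T x y \<Longrightarrow> T x y' \<Longrightarrow> y = y'"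
    and "\<And>x x' y. x \<in> X \<Longrightarrow> x' \<in> X \<Longrightarrow> y \<in> Y \<Longrightarrow> T x y \<Longrightarrow> T x' y \<Longrightarrow> x = x'"
  shows "\<exists>f. bij_betw f X Y"
proof -
  obtain f where f: "\<And>x. x \<in> X \<Longrightarrow> f x \<in> Y \<and> T x (f x)" using assms(1) by metis
  have "inj_on f X"
  proof (rule inj_onI)
    fix x x' assume h: "x \<in> X" "x' \<in> X" "f x = f x'"
    then have "T x' (f x)" using f[OF h(2)] by simp
    then show "x = x'" using assms(4)[OF h(1,2)] f[OF h(1)] by blast
  qed
  moreover have "y \<in> f ` X" if y: "y \<in> Y" for y
  proof -
    obtain x where x: "x \<in> X" "T x y" using assms(2)[OF y] by blast
    then have "y = f x" using assms(3)[OF x(1) y] f by blast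
    then show ?thesis using x by blast
  qed
  ultimately show ?thesis using f unfolding bij_betw_def by blast
qed

context root_arrangement
begin

section \<open>From signed affine roots back to floors and ceilings\<close>

lemma wall_level_ge:
  assumes "wall (catalan_arr \<Phi> k) R (hyp \<alpha> a)" "\<And>y. y \<in> R \<Longrightarrow> c < y \<bullet> \<alpha>"
  shows "c \<le> a"
proof -
  have "R \<subseteq> {y. \<alpha> \<bullet> y \<ge> c}" using assms(2) by (auto simp: inner_commute less_imp_le)
  then have "closure R \<subseteq> {y. \<alpha> \<bullet> y \<ge> c}" by (intro closure_minimal closed_halfspace_ge)
  moreover have "closure R \<inter> hyp \<alpha> a \<noteq> {}" using assms(1) unfolding wall_def facet_of_def by blast
  ultimately show ?thesis unfolding hyp_def by (auto simp: inner_commute)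
qed

lemma cross_wall_family:
  fixes T :: "('a \<times> int) set"
  assumes R: "R \<in> regions (catalan_arr \<Phi> k)" "dominant pos R"
    and P: "subsystem \<Psi>" "far_points \<Psi> R"
    and w: "w = v \<or> w = - v"
    and low: "\<And>\<alpha> y. \<alpha> \<in> \<Psi> \<Longrightarrow> \<alpha> \<bullet> w > 0 \<Longrightarrow> y \<in> R \<Longrightarrow> B \<le> y \<bullet> \<alpha>"
    and T: "\<And>b i. (b, i) \<in> T \<Longrightarrow> b \<in> \<Psi> \<and> b \<bullet> w > 0 \<and> \<bar>i\<bar> \<le> int k \<and> wall (catalan_arr \<Phi> k) R (hyp b (of_int i))"
    and ab: "\<And>b i y. (b, i) \<in> T \<Longrightarrow> y \<in> R \<Longrightarrow> of_int i < y \<bullet> b"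
    and sgn: "(\<forall>(b, i)\<in>T. i > 0) \<or> (\<forall>(b, i)\<in>T. i < 0)"
  shows "\<exists>R'\<in>regions (catalan_arr \<Phi> k). dominant pos R' \<and>
    crossing (\<Inter>(b, i)\<in>T. hyp b (of_int i)) R R' \<and>
    (\<forall>(b, i)\<in>T. wall (catalan_arr \<Phi> k) R' (hyp b (of_int i)) \<and> (\<forall>y\<in>R'. y \<bullet> b < of_int i))"
proof -
  \<comment> \<open>Each level is a lower bound on \<open>R\<close> and is attained on its wall, so
    a root occurs with one level only and \<open>T\<close> is the graph of
    \<open>\<kappa>\<close>.\<close>
  have uniq: "i = j" if "(b, i) \<in> T" "(b, j) \<in> T" for b i j
  proof -
    have "real_of_int i \<le> of_int j" "real_of_int j \<le> of_int i"
      using wall_level_ge[of R b] T ab that by blast+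
    then show ?thesis by simp
  qed
  define \<kappa> where "\<kappa> = (\<lambda>b. THE i. (b, i) \<in> T)"
  have \<kappa>: "\<kappa> b = i" if "(b, i) \<in> T" for b i unfolding \<kappa>_def using that uniq by blast
  have \<kappa>T: "(b, \<kappa> b) \<in> T" if "b \<in> fst ` T" for b using that \<kappa> by force
  have eq: "(\<Inter>(b, i)\<in>T. hyp b (of_int i)) = {y. \<forall>b\<in>fst ` T. y \<bullet> b = of_int (\<kappa> b)}"
    unfolding hyp_def using \<kappa> by force
  have "\<exists>R'\<in>regions (catalan_arr \<Phi> k). dominant pos R' \<and>
    crossing {y. \<forall>b\<in>fst ` T. y \<bullet> b = of_int (\<kappa> b)} R R' \<and>
    (\<forall>b\<in>fst ` T. wall (catalan_arr \<Phi> k) R' (hyp b (of_int (\<kappa> b))) \<and> (\<forall>y\<in>R'. y \<bullet> b < of_int (\<kappa> b)))"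
  proof (rule cross_walls[OF R P w low])
    show "b \<in> \<Psi> \<and> b \<bullet> w > 0 \<and> \<bar>\<kappa> b\<bar> \<le> int k \<and> wall (catalan_arr \<Phi> k) R (hyp b (of_int (\<kappa> b)))"
      if "b \<in> fst ` T" for b using T[OF \<kappa>T[OF that]] .
    show "of_int (\<kappa> b) < y \<bullet> b" if "b \<in> fst ` T" "y \<in> R" for b y using ab[OF \<kappa>T[OF that(1)] that(2)] .
    show "(\<forall>b\<in>fst ` T. \<kappa> b > 0) \<or> (\<forall>b\<in>fst ` T. \<kappa> b < 0)" using sgn \<kappa>T by blast
  qed
  moreover have "\<forall>(b, i)\<in>T. wall (catalan_arr \<Phi> k) R' (hyp b (of_int i)) \<and> (\<forall>y\<in>R'. y \<bullet> b < of_int i)"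
    if "\<forall>b\<in>fst ` T. wall (catalan_arr \<Phi> k) R' (hyp b (of_int (\<kappa> b))) \<and> (\<forall>y\<in>R'. y \<bullet> b < of_int (\<kappa> b))" for R'
    using that \<kappa> by force
  ultimately show ?thesis unfolding eq by blast
qed

text \<open>On a dominant region the positive roots are bounded below by 0, so no root has to be
  discarded: \<open>\<Psi> = \<Phi>\<close> and \<open>far_points\<close> is trivial.\<close>

lemma floors_to_ceilings:
  assumes M: "M \<subseteq> {hyp \<alpha> (real i) | \<alpha> i. \<alpha> \<in> pos \<and> i \<in> {1..k}}"
    and R: "R \<in> regions (catalan_arr \<Phi> k)" "dominant pos R" "\<forall>H\<in>M. floor_wall (catalan_arr \<Phi> k) R H"
  shows "\<exists>R'\<in>regions (catalan_arr \<Phi> k). dominant pos R' \<and> (\<forall>H\<in>M. ceiling (catalan_arr \<Phi> k) R' H) \<and> crossing (\<Inter>M) R R'"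
proof -
  define T where "T = {(\<alpha>, i). \<alpha> \<in> pos \<and> 1 \<le> i \<and> i \<le> int k \<and> hyp \<alpha> (of_int i) \<in> M}"
  have rep: "\<exists>(\<alpha>, i)\<in>T. H = hyp \<alpha> (of_int i)" if H: "H \<in> M" for H
  proof -
    obtain \<alpha> i where "H = hyp \<alpha> (real i)" "\<alpha> \<in> pos" "i \<in> {1..k}" using M H by blast
    then show ?thesis using H unfolding T_def by (intro bexI[of _ "(\<alpha>, int i)"]) auto
  qed
  have MT: "(\<Inter>(b, i)\<in>T. hyp b (of_int i)) = \<Inter>M"
  proof (intro equalityI subsetI)
    fix y assume "y \<in> (\<Inter>(b, i)\<in>T. hyp b (of_int i))" then show "y \<in> \<Inter>M" using rep by fastforce
  next
    fix y assume "y \<in> \<Inter>M" then show "y \<in> (\<Inter>(b, i)\<in>T. hyp b (of_int i))" unfolding T_def by auto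
  qed
  have "\<exists>R'\<in>regions (catalan_arr \<Phi> k). dominant pos R' \<and> crossing (\<Inter>(b, i)\<in>T. hyp b (of_int i)) R R' \<and>
    (\<forall>(b, i)\<in>T. wall (catalan_arr \<Phi> k) R' (hyp b (of_int i)) \<and> (\<forall>y\<in>R'. y \<bullet> b < of_int i))"
  proof (rule cross_wall_family[OF R(1,2) subsystem_all far_points_all])
    show "v = v \<or> v = - v" by simp
    show "0 \<le> y \<bullet> \<alpha>" if "\<alpha> \<in> \<Phi>" "\<alpha> \<bullet> v > 0" "y \<in> R" for \<alpha> y
      using R(2) that unfolding dominant_def pos_def by (auto simp: less_imp_le)
    show "b \<in> \<Phi> \<and> b \<bullet> v > 0 \<and> \<bar>i\<bar> \<le> int k \<and> wall (catalan_arr \<Phi> k) R (hyp b (of_int i))" if "(b, i) \<in> T" for b i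
      using that R(3) unfolding T_def pos_def floor_wall_def by auto
    show "of_int i < y \<bullet> b" if t: "(b, i) \<in> T" "y \<in> R" for b i y
    proof -
      have b: "b \<in> \<Phi>" "\<bar>i\<bar> \<le> int k" "real_of_int i > 0" "hyp b (of_int i) \<in> M" using t(1) unfolding T_def pos_def by auto
      then have "of_int i \<le> y \<bullet> b" using R(3) t(2) segment_meets_hyp_iff[OF b(3)] unfolding floor_wall_def by blast
      moreover have "y \<bullet> b \<noteq> of_int i" using region_eq(1)[OF R(1) t(2)] b unfolding generic_def by blast
      ultimately show ?thesis by simp
    qed
    show "(\<forall>(b, i)\<in>T. i > 0) \<or> (\<forall>(b, i)\<in>T. i < 0)" unfolding T_def by auto
  qed
  then obtain R' where R': "R' \<in> regions (catalan_arr \<Phi> k)" "dominant pos R'" "crossing (\<Inter>M) R R'"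
    "\<And>b i. (b, i) \<in> T \<Longrightarrow> wall (catalan_arr \<Phi> k) R' (hyp b (of_int i)) \<and> (\<forall>y\<in>R'. y \<bullet> b < of_int i)"
    unfolding MT by blast
  have "ceiling (catalan_arr \<Phi> k) R' H" if "H \<in> M" for H
  proof -
    obtain \<alpha> i where t: "(\<alpha>, i) \<in> T" "H = hyp \<alpha> (of_int i)" using rep \<open>H \<in> M\<close> by blast
    have i: "real_of_int i > 0" using t(1) unfolding T_def by auto
    have "closed_segment 0 y \<inter> H = {}" if "y \<in> R'" for y
      using R'(4)[OF t(1)] that segment_meets_hyp_iff[OF i, of y \<alpha>] unfolding t(2) by fastforce
    moreover have "0 \<notin> H" using i unfolding t(2) hyp_def by simp
    ultimately show ?thesis unfolding ceiling_def using R'(4)[OF t(1)] t(2) by blast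
  qed
  then show ?thesis using R' by blast
qed

text \<open>Entering a ceiling as the pair \<open>(- \<alpha>, - i)\<close> puts \<open>R\<close>
  above it. The roots of positive height with respect to \<open>- v\<close> are negative on
  \<open>R\<close> and may be unbounded below, which is why only \<open>bounded_roots R\<close> is
  used.\<close>

lemma ceilings_to_floors:
  assumes M: "M \<subseteq> {hyp \<alpha> (real i) | \<alpha> i. \<alpha> \<in> pos \<and> i \<in> {1..k}}"
    and R: "R \<in> regions (catalan_arr \<Phi> k)" "dominant pos R" "\<forall>H\<in>M. ceiling (catalan_arr \<Phi> k) R H"
  shows "\<exists>R'\<in>regions (catalan_arr \<Phi> k). dominant pos R' \<and> (\<forall>H\<in>M. floor_wall (catalan_arr \<Phi> k) R' H) \<and> crossing (\<Inter>M) R R'"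
proof -
  have hm: "hyp (- \<alpha>) (- r) = hyp \<alpha> r" for \<alpha> :: 'a and r by (auto simp: hyp_def)
  define T where "T = {(b, i). - b \<in> pos \<and> i \<le> - 1 \<and> - int k \<le> i \<and> hyp b (of_int i) \<in> M}"
  have rep: "\<exists>(\<alpha>, i)\<in>T. H = hyp \<alpha> (of_int i)" if H: "H \<in> M" for H
  proof -
    obtain \<alpha> i where "H = hyp \<alpha> (real i)" "\<alpha> \<in> pos" "i \<in> {1..k}" using M H by blast
    then show ?thesis using H unfolding T_def by (intro bexI[of _ "(- \<alpha>, - int i)"]) (auto simp: hm)
  qed
  have MT: "(\<Inter>(b, i)\<in>T. hyp b (of_int i)) = \<Inter>M"
  proof (intro equalityI subsetI)
    fix y assume "y \<in> (\<Inter>(b, i)\<in>T. hyp b (of_int i))" then show "y \<in> \<Inter>M" using rep by fastforce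
  next
    fix y assume "y \<in> \<Inter>M" then show "y \<in> (\<Inter>(b, i)\<in>T. hyp b (of_int i))" unfolding T_def by auto
  qed
  have "\<forall>\<beta>\<in>bounded_roots R. \<exists>C. \<forall>y\<in>R. \<bar>y \<bullet> \<beta>\<bar> \<le> C" unfolding bounded_roots_def by blast
  then obtain C where C: "\<And>\<beta> y. \<beta> \<in> bounded_roots R \<Longrightarrow> y \<in> R \<Longrightarrow> \<bar>y \<bullet> \<beta>\<bar> \<le> C \<beta>" by metis
  have fb: "finite (bounded_roots R)" using finite_roots unfolding bounded_roots_def by simp
  have ab: "of_int i < y \<bullet> b" if t: "(b, i) \<in> T" "y \<in> R" for b i y
  proof -
    have b: "real_of_int (- i) > 0" "hyp (- b) (of_int (- i)) \<in> M" using t(1) unfolding T_def by (auto simp: hm)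
    then have "\<not> of_int (- i) \<le> y \<bullet> (- b)" using R(3) t(2) segment_meets_hyp_iff[OF b(1)] unfolding ceiling_def by blast
    then show ?thesis by simp
  qed
  have "\<exists>R'\<in>regions (catalan_arr \<Phi> k). dominant pos R' \<and> crossing (\<Inter>(b, i)\<in>T. hyp b (of_int i)) R R' \<and>
    (\<forall>(b, i)\<in>T. wall (catalan_arr \<Phi> k) R' (hyp b (of_int i)) \<and> (\<forall>y\<in>R'. y \<bullet> b < of_int i))"
  proof (rule cross_wall_family[OF R(1,2) subsystem_bounded_roots far_points_bounded_roots[OF R(1,2)]])
    show "- v = v \<or> - v = - v" by simp
    \<comment> \<open>One lower bound for all roots at once: the sum dominates each single
      bound.\<close>
    show "- (\<Sum>\<beta>\<in>bounded_roots R. \<bar>C \<beta>\<bar>) \<le> y \<bullet> \<alpha>" if a: "\<alpha> \<in> bounded_roots R" "y \<in> R" for \<alpha> y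
    proof -
      have "\<bar>C \<alpha>\<bar> \<le> (\<Sum>\<beta>\<in>bounded_roots R. \<bar>C \<beta>\<bar>)" by (rule member_le_sum[OF a(1)]) (use fb in auto)
      then show ?thesis using C[OF a] by linarith
    qed
    show "b \<in> bounded_roots R \<and> b \<bullet> (- v) > 0 \<and> \<bar>i\<bar> \<le> int k \<and> wall (catalan_arr \<Phi> k) R (hyp b (of_int i))"
      if t: "(b, i) \<in> T" for b i
    proof -
      have b: "- b \<in> pos" "\<bar>i\<bar> \<le> int k" "hyp b (of_int i) \<in> M" using t unfolding T_def by auto
      then have "b \<in> \<Phi>" using root_uminus[OF crys, of "- b"] unfolding pos_def by simp
      \<comment> \<open>Dominance and the ceiling confine the value of \<open>- b\<close> between 0
        and the level, so the root of a ceiling is never discarded.\<close>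
      moreover have "\<bar>y \<bullet> b\<bar> \<le> - of_int i" if "y \<in> R" for y
      proof -
        have "0 < y \<bullet> (- b)" using R(2) b(1) that unfolding dominant_def by blast
        then show ?thesis using ab[OF t that] by simp
      qed
      ultimately have "b \<in> bounded_roots R" unfolding bounded_roots_def by blast
      moreover have "b \<bullet> (- v) > 0" using b(1) unfolding pos_def by simp
      ultimately show ?thesis using R(3) b unfolding ceiling_def by blast
    qed
    show "(\<forall>(b, i)\<in>T. i > 0) \<or> (\<forall>(b, i)\<in>T. i < 0)" unfolding T_def by auto
  qed (use ab in auto)
  then obtain R' where R': "R' \<in> regions (catalan_arr \<Phi> k)" "dominant pos R'" "crossing (\<Inter>M) R R'"
    "\<And>b i. (b, i) \<in> T \<Longrightarrow> wall (catalan_arr \<Phi> k) R' (hyp b (of_int i)) \<and> (\<forall>y\<in>R'. y \<bullet> b < of_int i)"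
    unfolding MT by blast
  have "floor_wall (catalan_arr \<Phi> k) R' H" if "H \<in> M" for H
  proof -
    obtain b i where t: "(b, i) \<in> T" "H = hyp b (of_int i)" using rep \<open>H \<in> M\<close> by blast
    have i: "- real_of_int i > 0" using t(1) unfolding T_def by auto
    have H: "H = hyp (- b) (- of_int i)" unfolding t(2) hm ..
    have "closed_segment 0 y \<inter> H \<noteq> {}" if "y \<in> R'" for y
      using R'(4)[OF t(1)] that segment_meets_hyp_iff[OF i, of y "- b"] unfolding H by fastforce
    moreover have "0 \<notin> H" using i unfolding t(2) hyp_def by simp
    ultimately show ?thesis unfolding floor_wall_def using R'(4)[OF t(1)] t(2) by blast
  qed
  then show ?thesis using R' by blast
qed

end

theorem theorem1:
  fixes \<Phi> \<Phi>p :: "'a::euclidean_space set" and k :: nat and M :: "'a set set"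
  assumes "crystallographic_root_system \<Phi>"
    and "positive_system \<Phi> \<Phi>p"
    and "k > 0"
    and "M \<subseteq> {hyp \<alpha> (real i) | \<alpha> i. \<alpha> \<in> \<Phi>p \<and> i \<in> {1..k}}"
  shows "\<exists>f. bij_betw f
           {R \<in> regions (catalan_arr \<Phi> k). dominant \<Phi>p R \<and> (\<forall>H\<in>M. floor_wall (catalan_arr \<Phi> k) R H)}
           {R \<in> regions (catalan_arr \<Phi> k). dominant \<Phi>p R \<and> (\<forall>H\<in>M. ceiling (catalan_arr \<Phi> k) R H)}"
proof -
  obtain v where v: "\<forall>\<alpha>\<in>\<Phi>. \<alpha> \<bullet> v \<noteq> 0" "\<Phi>p = {\<alpha>\<in>\<Phi>. \<alpha> \<bullet> v > 0}"
    using assms(2) unfolding positive_system_def by blast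
  interpret root_arrangement \<Phi> v k using assms(1) v(1) by unfold_locales auto
  have p: "\<Phi>p = pos" unfolding v(2) pos_def ..
  have M: "M \<subseteq> {hyp \<alpha> (real i) | \<alpha> i. \<alpha> \<in> pos \<and> i \<in> {1..k}}" using assms(4) unfolding p .
  show ?thesis unfolding p
  proof (rule bij_betw_of_unique_partners[where T = "crossing (\<Inter>M)"], goal_cases)
    case (1 R) then show ?case using floors_to_ceilings[OF M, of R] by auto
  next
    case (2 R) then show ?case using ceilings_to_floors[OF M, of R] crossing_sym by blast
  next
    case (3 R R1 R2) then show ?case using crossing_unique[of R R1 R2] by blast
  next
    case (4 R1 R2 R) then show ?case using crossing_unique[of R R1 R2] crossing_sym by blast
  qed
qed

end
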